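(* Let $n\geq 2$, let $A\in\mathbb{Z}^{m\times n}$ be an integral matrix of full column rank, let $\alpha\in\mathbb{Z}^n\setminus\{0\}$, $b\in\mathbb{Z}^m$ and $c\in\mathbb{Q}^n$. Let $x^*$ be an optimal vertex of the linear program $\max\{c^\top x : Ax\le b,\ x\in\mathbb{R}^n\}$. If the integer program $\max\{c^\top x : Ax\le b,\ x\in\mathbb{Z}^n\}$ is feasible, then it has an optimal solution $z^*$ such that \[ |\alpha^\top(x^*-z^* )|<\frac{4n+2}{9}\cdot\Delta^{\alpha}(A). \]
   Context: For $\alpha\in\mathbb{Z}^n$, $\Delta^{\alpha}(A)$ is the maximum of $\left|\det\begin{pmatrix}\alpha^\top\\ B\end{pmatrix}\right|$ over all $(n-1)\times n$ submatrices $B$ of $A$ (i.e., $B$ consists of $n-1$ rows of $A$). *)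

theory Defs
  imports "HOL-Analysis.Analysis"
begin

text \<open>Delta^alpha(A): maximum of |det [alpha; B]| over all choices B of n-1 rows of A.
  The row of the n x n matrix at index j0 is alpha; the remaining rows are rows f i of A.
  Permuting rows only changes the sign, and repeated row choices give determinant 0,
  so this equals the paper's maximum.\<close>
definition Delta_alpha :: "real^'n \<Rightarrow> real^'n^'m \<Rightarrow> real" where
  "Delta_alpha \<alpha> A =
     Max {\<bar>det (\<chi> i. if i = j0 then \<alpha> else A $ (f i))\<bar> | (j0::'n) (f::'n \<Rightarrow> 'm). True}"

definition polyhedron_of :: "real^'n^'m \<Rightarrow> real^'m \<Rightarrow> (real^'n) set" where
  "polyhedron_of A b = {x. \<forall>i. (A *v x) $ i \<le> b $ i}"

end

theory Submission
  imports Defs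
begin

text \<open>
  Among the optimal integer solutions let \<open>z\<close> minimise the total slack of the constraints that are tight
  at the vertex \<open>xstar\<close>, put \<open>x = xstar - z\<close>, and change the signs of the rows of \<open>A\<close> so that they are
  nonnegative on \<open>x\<close>; let \<open>G\<close> be the resulting set of rows. The spindle \<open>{w. \<forall>g\<in>G. 0 \<le> g \<bullet> w \<le> g \<bullet> x}\<close>
  is lattice-free in a strong sense: if \<open>w\<close> lies in it, \<open>\<bar>t\<bar> \<le> 1\<close> and all entries of \<open>A y\<close> are less than \<open>1\<close> in
  absolute value, then \<open>t w + y\<close> is not a nonzero integer vector, since by integrality of \<open>A\<close> and \<open>b\<close>
  it would lead from \<open>z\<close> to a better choice.

  If \<open>w\<close> is in the kernel of \<open>n - d\<close> independent rows of \<open>A\<close>, a volume argument for the cylinder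
  over \<open>{y. \<alpha> \<bullet> y = 0, \<bar>A y\<bar> < 1}\<close> inside this kernel bounds \<open>\<bar>\<alpha> \<bullet> w\<bar>\<close> by \<open>Delta_alpha \<alpha> A\<close> if \<open>d = 2\<close>, and
  by \<open>4/3\<close> of it if \<open>d = 3\<close>. The latter rests on a fact about the plane: if all pairs from a
  symmetric set have determinant at most \<open>1\<close>, the polar of the set has area at least \<open>3\<close>.

  Finally \<open>x\<close> is a sum of vectors of the spindle lying in kernels as above with \<open>d = 3\<close>, except for one
  with \<open>d = 2\<close> if \<open>n = 3 k + 2\<close> and two with \<open>d = 2\<close> if \<open>n = 3 k + 1\<close>. Adding up gives the bound.
\<close>

section \<open>Splitting a vector of the spindle\<close>

text \<open>As in the simplex method, \<open>s\<close> is the least ratio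
  \<open>p i / (- q i)\<close> over the indices with \<open>q i < 0\<close>, and a minimiser
  \<open>j\<close> becomes tight. Since \<open>q\<close> is nonnegative where \<open>p\<close>
  vanishes, these ratios are positive.\<close>

lemma ratio_test:
  fixes p q :: "'i \<Rightarrow> real"
  assumes "finite I" and p: "\<And>i. i \<in> I \<Longrightarrow> 0 \<le> p i"
    and q: "\<And>i. i \<in> I \<Longrightarrow> p i = 0 \<Longrightarrow> 0 \<le> q i"
    and neg: "\<exists>i\<in>I. q i < 0"
  obtains s j where "0 < s" "\<And>i. i \<in> I \<Longrightarrow> 0 \<le> p i + s * q i" "j \<in> I" "q j < 0" "p j + s * q j = 0"
proof -
  let ?N = "{i \<in> I. q i < 0}"
  have "finite ?N" "?N \<noteq> {}" using assms by auto
  then obtain j where j: "j \<in> ?N" and jmin: "\<And>i. i \<in> ?N \<Longrightarrow> p j / (- q j) \<le> p i / (- q i)"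
    using ex_is_arg_min_if_finite[of ?N "\<lambda>i. p i / (- q i)"] by (auto simp: is_arg_min_linorder)
  let ?s = "p j / (- q j)"
  have pj: "p j > 0" using j p[of j] q[of j] by force
  show ?thesis
  proof (rule that[of ?s j])
    show "0 < ?s" using pj j by (auto simp: divide_pos_neg)
    show "0 \<le> p i + ?s * q i" if "i \<in> I" for i
    proof (cases "q i < 0")
      case True
      then have "?s \<le> p i / (- q i)" using jmin that by auto
      then have "?s * (- q i) \<le> p i" using True pos_le_divide_eq[of "- q i" ?s "p i"] by linarith
      then show ?thesis by linarith
    next
      case False
      then have "0 \<le> ?s * q i" using \<open>0 < ?s\<close> by (intro mult_nonneg_nonneg) linarith+
      then show ?thesis using p[OF that] by linarith
    qed
    show "j \<in> I" "q j < 0" "p j + ?s * q j = 0" using j by auto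
  qed
qed

lemma dim_insert_orthogonal:
  fixes T :: "'a::euclidean_space set"
  assumes "\<And>h. h \<in> T \<Longrightarrow> h \<bullet> e = 0" "g \<bullet> e \<noteq> 0"
  shows "dim (insert g T) = dim T + 1"
proof -
  have "g \<notin> span T"
  proof
    assume "g \<in> span T"
    then have "orthogonal e g"
      by (rule orthogonal_to_span) (use assms(1) in \<open>auto simp: orthogonal_def inner_commute\<close>)
    then show False using assms(2) by (simp add: orthogonal_def inner_commute)
  qed
  then show ?thesis by (simp add: dim_insert)
qed

lemma full_dim_inner_eq_0:
  fixes H :: "'a::euclidean_space set"
  assumes "dim H = DIM('a)" "\<And>h. h \<in> H \<Longrightarrow> h \<bullet> e = 0"
  shows "e = 0"
proof -
  have "e \<in> span H" using assms(1) dim_eq_full by auto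
  then have "orthogonal e e"
    by (rule orthogonal_to_span) (use assms(2) in \<open>auto simp: orthogonal_def inner_commute\<close>)
  then show ?thesis by (simp add: orthogonal_def)
qed

text \<open>Take \<open>d\<close> with a tight set of largest dimension. If this is below
  \<open>n - 1\<close>, some \<open>e \<noteq> 0\<close> is orthogonal to \<open>f\<close> and to
  all tight rows. Moving along \<open>e\<close> keeps both until a row outside the span of the tight
  ones becomes tight, a contradiction.\<close>

lemma improving_extreme_ray:
  fixes H :: "'a::euclidean_space set"
  assumes "finite H" "dim H = DIM('a)" and d0: "\<And>h. h \<in> H \<Longrightarrow> 0 \<le> h \<bullet> d0" "f \<bullet> d0 < 0"
  obtains d where "\<And>h. h \<in> H \<Longrightarrow> 0 \<le> h \<bullet> d" "f \<bullet> d < 0" "DIM('a) \<le> dim {h\<in>H. h \<bullet> d = 0} + 1"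
proof -
  let ?D = "\<lambda>d. (\<forall>h\<in>H. 0 \<le> h \<bullet> d) \<and> f \<bullet> d < 0"
  let ?t = "\<lambda>d. dim {h\<in>H. h \<bullet> d = 0}"
  have "?D d0" using d0 by blast
  moreover have "\<forall>d. ?D d \<longrightarrow> ?t d < Suc DIM('a)" by (simp add: less_Suc_eq_le dim_subset_UNIV)
  ultimately have "\<exists>d. ?D d \<and> (\<forall>d'. ?D d' \<longrightarrow> ?t d' \<le> ?t d)"
    by (rule ex_has_greatest_nat[where P = ?D and f = ?t])
  then obtain d where d: "?D d" and dmax: "\<And>d'. ?D d' \<Longrightarrow> ?t d' \<le> ?t d"
    by blast
  have "DIM('a) \<le> ?t d + 1"
  proof (rule ccontr)
    assume n: "\<not> DIM('a) \<le> ?t d + 1"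
    let ?T = "{h\<in>H. h \<bullet> d = 0}"
    have "dim (insert f ?T) < DIM('a)" using n by (simp add: dim_insert)
    then obtain e where e: "e \<noteq> 0" "\<And>y. y \<in> span (insert f ?T) \<Longrightarrow> orthogonal e y"
      using orthogonal_to_subspace_exists by blast
    have e0: "y \<bullet> e = 0" if "y \<in> insert f ?T" for y
      using e(2)[OF span_base[OF that]] by (simp add: orthogonal_def inner_commute)
    obtain h where h: "h \<in> H" "h \<bullet> e \<noteq> 0"
      using full_dim_inner_eq_0[OF assms(2)] e(1) by blast
    \<comment> \<open>As \<open>H\<close> spans the space, some \<open>h\<close> is nonzero on
      \<open>e\<close>. The sign makes it decrease along \<open>e'\<close>, so the ratio test does
      stop.\<close>
    define e' where "e' = (if h \<bullet> e < 0 then e else - e)"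
    have e'0: "y \<bullet> e' = 0" if "y \<in> insert f ?T" for y
      using e0[OF that] by (auto simp: e'_def)
    have he': "h \<bullet> e' < 0" using h by (auto simp: e'_def)
    obtain s j where sj: "0 < s" "\<And>i. i \<in> H \<Longrightarrow> 0 \<le> i \<bullet> d + s * (i \<bullet> e')" "j \<in> H"
        "j \<bullet> e' < 0" "j \<bullet> d + s * (j \<bullet> e') = 0"
      by (rule ratio_test[of H "\<lambda>h. h \<bullet> d" "\<lambda>h. h \<bullet> e'"])
         (use assms(1) d h(1) he' e'0 in auto)
    let ?d' = "d + s *\<^sub>R e'"
    have "?D ?d'" using sj(2) d e'0[of f] by (auto simp: inner_add_right)
    then have "?t ?d' \<le> ?t d" by (rule dmax)
    moreover have "insert j ?T \<subseteq> {h\<in>H. h \<bullet> ?d' = 0}"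
      using sj e'0 by (auto simp: inner_add_right)
    then have "dim (insert j ?T) \<le> ?t ?d'" by (rule dim_subset)
    moreover have "dim (insert j ?T) = ?t d + 1"
      by (rule dim_insert_orthogonal[of _ e']) (use e'0 sj in auto)
    ultimately show False by simp
  qed
  then show ?thesis using that d by blast
qed

lemma dim_Un_submodular:
  fixes S T E :: "'a::euclidean_space set"
  assumes "E \<subseteq> S" "E \<subseteq> T"
  shows "dim (S \<union> T) + dim E \<le> dim S + dim T"
proof -
  have "dim {x + y |x y. x \<in> span S \<and> y \<in> span T} + dim (span S \<inter> span T) = dim (span S) + dim (span T)"
    by (rule dim_sums_Int) auto
  moreover have "{x + y |x y. x \<in> span S \<and> y \<in> span T} = span (S \<union> T)"
    by (auto simp: span_Un)
  moreover have "dim E \<le> dim (span S \<inter> span T)"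
    by (rule dim_subset) (use assms span_superset in blast)
  ultimately show ?thesis by simp
qed

text \<open>Walking down the vertices of the spindle \<open>{y. \<forall>g\<in>G. 0 \<le> g \<bullet> y \<le> g \<bullet> x}\<close> from \<open>x\<close> to \<open>0\<close>, the last
  one with \<open>dim {g\<in>G. g \<bullet> w = g \<bullet> x} + l \<ge> n\<close> is the desired \<open>w\<close>: every edge leaving it has
  a tight set of dimension \<open>n - 1\<close>, so too small a dimension of \<open>{g\<in>G. g \<bullet> w = 0}\<close> would allow
  another step.\<close>
lemma spindle_split:
  fixes G :: "'a::euclidean_space set"
  assumes fin: "finite G" and full: "dim G = DIM('a)" and x: "\<And>g. g \<in> G \<Longrightarrow> 0 \<le> g \<bullet> x"
    and kl: "DIM('a) \<le> dim {g\<in>G. g \<bullet> x = 0} + (k + l)"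
  obtains w where "\<And>g. g \<in> G \<Longrightarrow> 0 \<le> g \<bullet> w \<and> g \<bullet> w \<le> g \<bullet> x"
    "DIM('a) \<le> dim {g\<in>G. g \<bullet> w = 0} + k" "DIM('a) \<le> dim {g\<in>G. g \<bullet> (x - w) = 0} + l"
proof -
  let ?S = "{y. \<forall>g\<in>G. 0 \<le> g \<bullet> y \<and> g \<bullet> y \<le> g \<bullet> x}"
  let ?R0 = "\<lambda>y. {g\<in>G. g \<bullet> y = 0}" and ?R1 = "\<lambda>y. {g\<in>G. g \<bullet> y = g \<bullet> x}"
  \<comment> \<open>\<open>f\<close> is positive on every nonzero point of the cone given by
    \<open>G\<close>, so it measures progress of the walk towards \<open>0\<close>.\<close>
  define f where "f = \<Sum>G"
  have fpos: "0 < f \<bullet> y" if y: "\<And>g. g \<in> G \<Longrightarrow> 0 \<le> g \<bullet> y" "y \<noteq> 0" for y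
  proof -
    obtain g where "g \<in> G" "g \<bullet> y \<noteq> 0" using full_dim_inner_eq_0[OF full] y(2) by blast
    then have "0 < (\<Sum>g\<in>G. g \<bullet> y)" using y(1) fin
      by (intro sum_pos2[of _ g]) (auto simp: order_less_le)
    then show ?thesis by (simp add: f_def inner_sum_left)
  qed
  \<comment> \<open>The vertices of the spindle. Each is determined by the sets of rows tight at
    either bound, so there are finitely many.\<close>
  let ?V = "{y\<in>?S. dim (?R0 y \<union> ?R1 y) = DIM('a)}"
  have "inj_on (\<lambda>y. (?R0 y, ?R1 y)) ?V"
  proof (rule inj_onI)
    fix y y' assume y: "y \<in> ?V" and y': "y' \<in> ?V" and eq: "(?R0 y, ?R1 y) = (?R0 y', ?R1 y')"
    have "g \<bullet> (y - y') = 0" if "g \<in> ?R0 y \<union> ?R1 y" for g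
      using that eq by (auto simp: inner_diff_right set_eq_iff)
    then have "y - y' = 0" using y full_dim_inner_eq_0[of "?R0 y \<union> ?R1 y" "y - y'"] by blast
    then show "y = y'" by simp
  qed
  moreover have "(\<lambda>y. (?R0 y, ?R1 y)) ` ?V \<subseteq> Pow G \<times> Pow G" by auto
  ultimately have finV: "finite ?V"
    by (meson fin finite_Pow_iff finite_SigmaI inj_on_finite)
  let ?W = "{y\<in>?V. DIM('a) \<le> dim (?R1 y) + l}"
  have "?R0 x \<union> ?R1 x = G" "?R1 x = G" by auto
  then have "x \<in> ?W" using x full by simp
  then have "?W \<noteq> {}" by blast
  moreover have "finite ?W" by (rule finite_subset[OF _ finV]) blast
  ultimately obtain w where w: "w \<in> ?W" and wmin: "\<And>y. y \<in> ?W \<Longrightarrow> f \<bullet> w \<le> f \<bullet> y"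
    using ex_is_arg_min_if_finite[of ?W "\<lambda>y. f \<bullet> y"] by (auto simp: is_arg_min_linorder)
  have "DIM('a) \<le> dim (?R0 w) + k"
  proof (rule ccontr)
    assume neg: "\<not> DIM('a) \<le> dim (?R0 w) + k"
    have "w \<noteq> 0" using neg full by auto
    \<comment> \<open>\<open>?H\<close> cuts out the cone of directions that stay in the spindle
      near \<open>w\<close>. It contains \<open>- w\<close>, along which \<open>f\<close> decreases,
      so \<open>f\<close> also decreases along some edge \<open>d\<close> at
      \<open>w\<close>.\<close>
    let ?H = "?R0 w \<union> uminus ` ?R1 w"
    have "?R0 w \<union> ?R1 w \<subseteq> span ?H"
    proof
      fix g assume "g \<in> ?R0 w \<union> ?R1 w"
      then show "g \<in> span ?H"
      proof
        assume "g \<in> ?R1 w"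
        then have "- g \<in> span ?H" by (blast intro: span_base)
        then show ?thesis using span_neg by fastforce
      qed (blast intro: span_base)
    qed
    then have "dim (?R0 w \<union> ?R1 w) \<le> dim ?H" using dim_subset[of _ "span ?H"] by simp
    then have dimH: "dim ?H = DIM('a)" using w dim_subset_UNIV[of ?H] by auto
    obtain d where d: "\<And>h. h \<in> ?H \<Longrightarrow> 0 \<le> h \<bullet> d" "f \<bullet> d < 0" "DIM('a) \<le> dim {h\<in>?H. h \<bullet> d = 0} + 1"
    proof (rule improving_extreme_ray[of ?H "- w" f])
      show "finite ?H" using fin by auto
      show "0 \<le> h \<bullet> - w" if "h \<in> ?H" for h using that w by auto
      show "f \<bullet> - w < 0" using fpos[of w] \<open>w \<noteq> 0\<close> w by auto
    qed (use dimH in auto)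
    let ?T0 = "{g\<in>?R0 w. g \<bullet> d = 0}" and ?T1 = "{g\<in>?R1 w. g \<bullet> d = 0}"
    have d0: "0 \<le> g \<bullet> d" if "g \<in> ?R0 w" for g using d(1)[of g] that by blast
    have d1: "g \<bullet> d \<le> 0" if "g \<in> ?R1 w" for g using d(1)[of "- g"] that by auto
    have "{h\<in>?H. h \<bullet> d = 0} \<subseteq> span (?T0 \<union> ?T1)"
    proof
      fix h assume "h \<in> {h\<in>?H. h \<bullet> d = 0}"
      then consider "h \<in> ?T0 \<union> ?T1" | "- h \<in> ?T0 \<union> ?T1" by force
      then show "h \<in> span (?T0 \<union> ?T1)"
      proof cases
        case 2
        then have "- h \<in> span (?T0 \<union> ?T1)" by (rule span_base)
        then show ?thesis using span_neg by fastforce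
      qed (rule span_base)
    qed
    then have "dim {h\<in>?H. h \<bullet> d = 0} \<le> dim (?T0 \<union> ?T1)"
      using dim_subset[of _ "span (?T0 \<union> ?T1)"] by simp
    then have dT: "DIM('a) \<le> dim (?T0 \<union> ?T1) + 1" using d(3) by linarith
    \<comment> \<open>A row vanishing at \<open>x\<close> is tight at both bounds at
      \<open>w\<close>, so it lies in \<open>?T0\<close> and \<open>?T1\<close>. Submodularity then
      gives \<open>dim ?T1 \<ge> (n - 1) + (n - k - l) - (n - k - 1) = n - l\<close>.\<close>
    have "g \<bullet> w = 0 \<and> g \<bullet> d = 0" if "g \<in> ?R0 x" for g
    proof -
      have "g \<bullet> w = 0" using that w by force
      then show ?thesis using that d0[of g] d1[of g] by auto
    qed
    then have "?R0 x \<subseteq> ?T0" "?R0 x \<subseteq> ?T1" by auto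
    then have "dim (?T0 \<union> ?T1) + dim (?R0 x) \<le> dim ?T0 + dim ?T1" by (rule dim_Un_submodular)
    moreover have "dim ?T0 \<le> dim (?R0 w)" by (rule dim_subset) auto
    ultimately have T1: "DIM('a) \<le> dim ?T1 + l" using dT neg kl by linarith
    \<comment> \<open>Each row carries the constraint \<open>0 \<le> g \<bullet> y\<close>, marked
      \<open>True\<close>, and \<open>g \<bullet> y \<le> g \<bullet> x\<close>, marked
      \<open>False\<close>. The ratio test over both kinds finds the far end of the edge, a member
      of \<open>?W\<close> with smaller \<open>f\<close>.\<close>
    let ?I = "G \<times> {True, False}"
    let ?p = "\<lambda>(g, c). if c then g \<bullet> w else g \<bullet> x - g \<bullet> w"
    let ?q = "\<lambda>(g, c). if c then g \<bullet> d else - (g \<bullet> d)"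
    have "\<exists>g\<in>G. g \<bullet> d < 0"
    proof (rule ccontr)
      assume "\<not> ?thesis"
      then have "0 \<le> (\<Sum>g\<in>G. g \<bullet> d)" by (intro sum_nonneg) auto
      then show False using d(2) by (simp add: f_def inner_sum_left)
    qed
    then have neg_q: "\<exists>i\<in>?I. ?q i < 0" by force
    have p_nonneg: "0 \<le> ?p i" if "i \<in> ?I" for i using that w by auto
    have q_nonneg: "0 \<le> ?q i" if "i \<in> ?I" "?p i = 0" for i
      using that d0 d1 by (auto split: if_splits)
    obtain s j where sj: "0 < s" "\<And>i. i \<in> ?I \<Longrightarrow> 0 \<le> ?p i + s * ?q i"
        "j \<in> ?I" "?q j < 0" "?p j + s * ?q j = 0"
      by (rule ratio_test[of ?I ?p ?q, OF _ p_nonneg q_nonneg neg_q]) (use fin in auto)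
    obtain g c where j: "j = (g, c)" by (cases j)
    let ?w = "w + s *\<^sub>R d"
    have "0 \<le> g \<bullet> ?w \<and> g \<bullet> ?w \<le> g \<bullet> x" if "g \<in> G" for g
      using sj(2)[of "(g, True)"] sj(2)[of "(g, False)"] that by (auto simp: inner_add_right)
    then have wS: "?w \<in> ?S" by blast
    have g: "g \<in> ?R0 ?w \<union> ?R1 ?w" "g \<bullet> d \<noteq> 0"
      using sj(3,4,5) j by (auto simp: inner_add_right split: if_splits)
    have "insert g (?T0 \<union> ?T1) \<subseteq> ?R0 ?w \<union> ?R1 ?w" using g by (auto simp: inner_add_right)
    then have "dim (insert g (?T0 \<union> ?T1)) \<le> dim (?R0 ?w \<union> ?R1 ?w)" by (rule dim_subset)
    moreover have "dim (insert g (?T0 \<union> ?T1)) = dim (?T0 \<union> ?T1) + 1"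
      by (rule dim_insert_orthogonal[of _ d]) (use g in auto)
    ultimately have "dim (?R0 ?w \<union> ?R1 ?w) = DIM('a)"
      using dT dim_subset_UNIV[of "?R0 ?w \<union> ?R1 ?w"] by linarith
    moreover have "dim ?T1 \<le> dim (?R1 ?w)" by (rule dim_subset) (auto simp: inner_add_right)
    ultimately have "?w \<in> ?W" using wS T1 by auto
    then have "f \<bullet> w \<le> f \<bullet> ?w" by (rule wmin)
    moreover have "s * (f \<bullet> d) < 0" using sj(1) d(2) by (simp add: mult_pos_neg)
    ultimately show False by (simp add: inner_add_right)
  qed
  moreover have "{g\<in>G. g \<bullet> (x - w) = 0} = ?R1 w" by (auto simp: inner_diff_right)
  ultimately show ?thesis using that[of w] w by auto
qed

section \<open>Lattice packings and prisms\<close>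

text \<open>Multilinearity in the rows \<open>a\<close> and \<open>b\<close> expands the determinant
  into the \<open>D j k\<close>. Those with a repeated row vanish; \<open>D a b\<close> and
  \<open>D b a\<close> differ by a row swap, which leaves a 2 by 2 minor as coefficient.\<close>

lemma det_replace_two_rows:
  fixes M :: "real^'n^'n"
  assumes ab: "a \<noteq> b"
  shows "det (\<chi> i. if i = a then \<Sum>j\<in>UNIV. \<kappa> j *s M $ j
                else if i = b then \<Sum>j\<in>UNIV. \<kappa>' j *s M $ j else M $ i)
       = (\<kappa> a * \<kappa>' b - \<kappa> b * \<kappa>' a) * det M" (is "det ?N = _")
proof -
  define D where "D j k = det (\<chi> i. if i = a then M $ j else if i = b then M $ k else M $ i)" for j k
  have swap: "D b a = - det M"
  proof -
    have "(\<chi> i. if i = a then M $ b else if i = b then M $ a else M $ i) = (\<chi> i. M $ Transposition.transpose a b i)"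
      by (auto simp: vec_eq_iff Transposition.transpose_def)
    then show ?thesis
      using det_permute_rows[of "Transposition.transpose a b" M] ab
      by (simp add: D_def permutes_swap_id sign_swap_id)
  qed
  have Dab: "D a b = det M" unfolding D_def by (rule arg_cong[of _ _ det]) (auto simp: vec_eq_iff)
  have D0: "D j k = 0" if "\<not> (j = a \<and> k = b)" "\<not> (j = b \<and> k = a)" for j k
  proof -
    let ?X = "\<chi> i. if i = a then M $ j else if i = b then M $ k else M $ i"
    have "\<exists>i i'. i \<noteq> i' \<and> row i ?X = row i' ?X"
    proof (cases "j = k")
      case True
      then show ?thesis using ab by (intro exI[of _ a] exI[of _ b]) (auto simp: row_def)
    next
      case False
      show ?thesis
      proof (cases "j = a \<or> j = b")
        case True
        then have "k \<noteq> a" "k \<noteq> b" using False that by auto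
        then show ?thesis using ab by (intro exI[of _ b] exI[of _ k]) (auto simp: row_def)
      next
        case False
        then show ?thesis using ab by (intro exI[of _ a] exI[of _ j]) (auto simp: row_def)
      qed
    qed
    then show ?thesis unfolding D_def using det_identical_rows by blast
  qed
  have "det ?N = (\<Sum>j\<in>UNIV. \<kappa> j * det (\<chi> i. if i = a then M $ j
                else if i = b then \<Sum>k\<in>UNIV. \<kappa>' k *s M $ k else M $ i))"
    by (subst det_linear_row_sum) (simp_all add: det_row_mul)
  also have "\<dots> = (\<Sum>j\<in>UNIV. \<kappa> j * (\<Sum>k\<in>UNIV. \<kappa>' k * D j k))"
  proof (intro sum.cong refl arg_cong2[of _ _ _ _ "(*)"])
    fix j
    have *: "(\<chi> i. if i = a then M $ j else if i = b then v else M $ i)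
        = (\<chi> i. if i = b then v else if i = a then M $ j else M $ i)" for v
      using ab by (auto simp: vec_eq_iff)
    show "det (\<chi> i. if i = a then M $ j else if i = b then \<Sum>k\<in>UNIV. \<kappa>' k *s M $ k else M $ i)
        = (\<Sum>k\<in>UNIV. \<kappa>' k * D j k)"
      unfolding D_def * by (subst det_linear_row_sum) (simp_all add: det_row_mul)
  qed
  also have "\<dots> = (\<Sum>j\<in>UNIV. \<kappa> j * ((if j = a then \<kappa>' b * det M else 0) - (if j = b then \<kappa>' a * det M else 0)))"
  proof (intro sum.cong refl arg_cong2[of _ _ _ _ "(*)"])
    fix j
    have "(\<Sum>k\<in>UNIV. \<kappa>' k * D j k) =
        (\<Sum>k\<in>UNIV. (if k = b then if j = a then \<kappa>' b * det M else 0 else 0)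
          - (if k = a then if j = b then \<kappa>' a * det M else 0 else 0))"
      by (intro sum.cong refl) (use ab D0 Dab swap in auto)
    then show "(\<Sum>k\<in>UNIV. \<kappa>' k * D j k) = (if j = a then \<kappa>' b * det M else 0) - (if j = b then \<kappa>' a * det M else 0)"
      by (simp add: sum_subtractf)
  qed
  also have "\<dots> = (\<Sum>j\<in>UNIV. (if j = a then \<kappa> a * \<kappa>' b * det M else 0) - (if j = b then \<kappa> b * \<kappa>' a * det M else 0))"
    by (intro sum.cong refl) (auto simp: algebra_simps)
  also have "\<dots> = (\<kappa> a * \<kappa>' b - \<kappa> b * \<kappa>' a) * det M"
    by (simp add: sum_subtractf algebra_simps)
  finally show ?thesis .
qed

text \<open>The translates by vectors with entries in \<open>{..<Suc N}\<close> are disjoint and fit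
  into a box of side \<open>Suc N + 2 * c\<close>. Comparing volumes bounds the sum by
  \<open>(1 + 2 * c / Suc N) ^ n\<close>, which tends to \<open>1\<close>.\<close>

lemma measure_lattice_packing_le_1:
  fixes X :: "'i \<Rightarrow> (real^'n) set"
  assumes fin: "finite I" and meas: "\<And>i. i \<in> I \<Longrightarrow> X i \<in> lmeasurable"
    and bdd: "\<And>i. i \<in> I \<Longrightarrow> bounded (X i)"
    and disj: "\<And>i i' z z'. \<lbrakk>i \<in> I; i' \<in> I; \<forall>k. z $ k \<in> \<int>; \<forall>k. z' $ k \<in> \<int>; (i, z) \<noteq> (i', z')\<rbrakk>
       \<Longrightarrow> (+) z ` X i \<inter> (+) z' ` X i' = {}"
  shows "(\<Sum>i\<in>I. measure lebesgue (X i)) \<le> 1"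
proof -
  let ?n = "CARD('n)"
  have "bounded (\<Union>i\<in>I. X i)" using fin bdd by auto
  then obtain c where c: "0 < c" "\<And>x. x \<in> (\<Union>i\<in>I. X i) \<Longrightarrow> norm x \<le> c"
    using bounded_pos by (metis)
  let ?S = "\<Sum>i\<in>I. measure lebesgue (X i)"
  have bound: "?S \<le> (1 + 2 * c / real (Suc N)) ^ ?n" for N
  proof -
    let ?F = "UNIV \<rightarrow>\<^sub>E {..<Suc N} :: ('n \<Rightarrow> nat) set"
    let ?v = "\<lambda>f::'n \<Rightarrow> nat. (\<chi> k. real (f k)) :: real^'n"
    let ?Y = "\<lambda>(i, f). (+) (?v f) ` X i"
    have finF: "finite ?F" by (intro finite_PiE) auto
    have cardF: "card ?F = Suc N ^ ?n" by (simp add: card_PiE)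
    have vinj: "f = g" if "?v f = ?v g" for f g using that by (auto simp: vec_eq_iff)
    have "measure lebesgue (\<Union>p\<in>I \<times> ?F. ?Y p) = (\<Sum>p\<in>I \<times> ?F. measure lebesgue (?Y p))"
    proof (rule measure_UNION')
      show "finite (I \<times> ?F)" using fin finF by blast
      show "?Y p \<in> lmeasurable" if "p \<in> I \<times> ?F" for p
        using that meas by (auto simp: measurable_translation)
      show "pairwise (\<lambda>p q. disjnt (?Y p) (?Y q)) (I \<times> ?F)"
      proof (intro pairwiseI)
        fix p q assume p: "p \<in> I \<times> ?F" and q: "q \<in> I \<times> ?F" and "p \<noteq> q"
        then obtain i f i' g where pq: "p = (i, f)" "q = (i', g)" "i \<in> I" "i' \<in> I" "(i, f) \<noteq> (i', g)"
          by blast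
        then have "(i, ?v f) \<noteq> (i', ?v g)" using vinj by blast
        then show "disjnt (?Y p) (?Y q)"
          using disj[of i i' "?v f" "?v g"] pq by (simp add: disjnt_def)
      qed
    qed
    also have "\<dots> = (\<Sum>i\<in>I. \<Sum>f\<in>?F. measure lebesgue (X i))"
      unfolding sum.cartesian_product by (intro sum.cong) (auto simp: measure_translation)
    also have "\<dots> = real (Suc N) ^ ?n * ?S"
      using cardF by (simp add: sum_distrib_left)
    finally have eq: "measure lebesgue (\<Union>p\<in>I \<times> ?F. ?Y p) = real (Suc N) ^ ?n * ?S" .
    let ?B = "cbox (\<chi> k. - c) (\<chi> k. real (Suc N) + c) :: (real^'n) set"
    have sub: "(\<Union>p\<in>I \<times> ?F. ?Y p) \<subseteq> ?B"
    proof clarsimp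
      fix i f x assume i: "i \<in> I" and f: "f \<in> ?F" and x: "x \<in> X i"
      have xk: "\<bar>x $ k\<bar> \<le> c" for k
        using c(2)[of x] i x component_le_norm_cart[of x k] by force
      have fk: "f k < Suc N" for k using f by auto
      have "real (f k) \<le> real (Suc N)" for k using fk[of k] by linarith
      then show "?v f + x \<in> cbox (\<chi> k. - c) (\<chi> k. 1 + real N + c)"
        using xk by (auto simp: mem_box_cart abs_le_iff) (smt (verit, best) of_nat_0_le_iff of_nat_Suc)+
    qed
    have "measure lebesgue (\<Union>p\<in>I \<times> ?F. ?Y p) \<le> measure lebesgue ?B"
    proof (rule measure_mono_fmeasurable[OF sub])
      show "(\<Union>p\<in>I \<times> ?F. ?Y p) \<in> sets lebesgue"
        by (rule sets.finite_UN) (use fin finF meas in \<open>auto intro!: fmeasurableD simp: measurable_translation\<close>)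
    qed auto
    also have "\<dots> = (real (Suc N) + 2 * c) ^ ?n"
    proof -
      have ne: "?B \<noteq> {}" using c(1) by (simp add: interval_ne_empty_cart)
      then show ?thesis by (simp add: content_cbox_cart) (simp add: algebra_simps)
    qed
    finally have "real (Suc N) ^ ?n * ?S \<le> (real (Suc N) + 2 * c) ^ ?n" unfolding eq .
    then have "?S \<le> (real (Suc N) + 2 * c) ^ ?n / real (Suc N) ^ ?n"
      by (subst pos_le_divide_eq) (simp_all add: mult.commute)
    also have "\<dots> = (1 + 2 * c / real (Suc N)) ^ ?n"
      unfolding power_divide[symmetric] by (simp add: add_divide_distrib)
    finally show ?thesis .
  qed
  have "(\<lambda>N. (1 + 2 * c * inverse (real (Suc N))) ^ ?n) \<longlonglongrightarrow> (1 + 2 * c * 0) ^ ?n"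
    by (intro tendsto_intros LIMSEQ_inverse_real_of_nat)
  then have "(\<lambda>N. (1 + 2 * c / real (Suc N)) ^ ?n) \<longlonglongrightarrow> 1" by (simp add: divide_inverse)
  then show ?thesis by (rule LIMSEQ_le_const) (use bound in blast)
qed

text \<open>Unlike \<open>measure_linear_image\<close>, this does not require the index type to be well-ordered.\<close>
lemma linear_image_lebesgue_cart:
  fixes f :: "real^'n \<Rightarrow> real^'n"
  assumes "linear f" "S \<in> lmeasurable"
  shows "f ` S \<in> lmeasurable \<and> measure lebesgue (f ` S) = \<bar>det (matrix f)\<bar> * measure lebesgue S"
proof -
  let ?Q = "\<lambda>f::real^'n \<Rightarrow> real^'n. \<forall>S\<in>lmeasurable.
      f ` S \<in> lmeasurable \<and> measure lebesgue (f ` S) = \<bar>det (matrix f)\<bar> * measure lebesgue S"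
  \<comment> \<open>Used for coordinate swaps and shears, where it is enough that boxes keep their
    measure.\<close>
  have suff: "?Q h" if lin: "linear h" and det: "\<bar>det (matrix h)\<bar> = 1"
    and box: "\<And>a b. cbox a b \<noteq> {} \<Longrightarrow> measure lebesgue (h ` cbox a b) = measure lebesgue (cbox a b)"
    for h :: "real^'n \<Rightarrow> real^'n"
  proof
    fix S :: "(real^'n) set" assume S: "S \<in> lmeasurable"
    have "measure lebesgue (h ` cbox a b) = 1 * measure lebesgue (cbox a b)" for a b
      using box[of a b] by (cases "cbox a b = {}") simp_all
    from measure_linear_sufficient[OF lin S this]
    show "h ` S \<in> lmeasurable \<and> measure lebesgue (h ` S) = \<bar>det (matrix h)\<bar> * measure lebesgue S"
      by (simp add: det)
  qed
  have "?Q f"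
  proof (rule induct_linear_elementary[OF assms(1), where P = ?Q])
    fix f g :: "real^'n \<Rightarrow> real^'n" assume fg: "linear f" "linear g" "?Q f" "?Q g"
    show "?Q (f \<circ> g)"
    proof
      fix S :: "(real^'n) set" assume "S \<in> lmeasurable"
      moreover have "(f \<circ> g) ` S = f ` g ` S" by (simp add: image_comp)
      ultimately show "(f \<circ> g) ` S \<in> lmeasurable
          \<and> measure lebesgue ((f \<circ> g) ` S) = \<bar>det (matrix (f \<circ> g))\<bar> * measure lebesgue S"
        using fg(3,4) matrix_compose[OF fg(2,1)] by (simp add: det_mul abs_mult)
    qed
  next
    fix f :: "real^'n \<Rightarrow> real^'n" and i assume lin: "linear f" and i: "\<And>x. f x $ i = 0"
    have "\<not> surj f" using i by (metis axis_nth surjD zero_neq_one)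
    then have ninj: "\<not> inj f" using lin linear_injective_imp_surjective by blast
    then have "det (matrix f) = 0" using det_nz_iff_inj[OF lin] by blast
    moreover have "negligible (f ` S)" for S
      by (rule negligible_linear_singular_image[OF lin ninj])
    ultimately show "?Q f" by (simp add: negligible_iff_measure)
  next
    fix c :: "'n \<Rightarrow> real"
    have "det (matrix (\<lambda>x::real^'n. \<chi> i. c i * x $ i)) = prod c UNIV"
      by (subst det_diagonal) (simp_all add: matrix_def axis_def)
    then show "?Q (\<lambda>x. \<chi> i. c i * x $ i)" by (simp add: measurable_stretch measure_stretch)
  next
    fix m n :: 'n assume mn: "m \<noteq> n"
    let ?t = "Transposition.transpose m n"
    let ?h = "\<lambda>x::real^'n. \<chi> i. x $ ?t i"
    have lin: "linear ?h" by (rule linearI) (simp_all add: vec_eq_iff)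
    have "matrix ?h = (\<chi> i. (mat 1 :: real^'n^'n) $ ?t i)"
      by (simp add: matrix_def mat_def axis_def vec_eq_iff eq_commute)
    then have "\<bar>det (matrix ?h)\<bar> = 1"
      using det_permute_rows[of ?t "mat 1 :: real^'n^'n"] mn
      by (simp add: permutes_swap_id sign_swap_id)
    then show "?Q ?h"
    proof (rule suff[OF lin])
      fix a b :: "real^'n" assume ne: "cbox a b \<noteq> {}"
      have img: "?h ` cbox a b = cbox (?h a) (?h b)"
      proof (intro equalityI subsetI)
        fix x assume x: "x \<in> cbox (?h a) (?h b)"
        have "a $ i \<le> x $ ?t i \<and> x $ ?t i \<le> b $ i" for i
          using x[unfolded mem_box_cart, rule_format, of "?t i"] by simp
        then have "?h x \<in> cbox a b" by (simp add: mem_box_cart)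
        moreover have "x = ?h (?h x)" by (simp add: vec_eq_iff)
        ultimately show "x \<in> ?h ` cbox a b" by (rule rev_image_eqI)
      qed (auto simp: mem_box_cart)
      moreover have "cbox (?h a) (?h b) \<noteq> {}" using ne img by (metis image_is_empty)
      ultimately have "measure lebesgue (?h ` cbox a b) = (\<Prod>i\<in>UNIV. b $ ?t i - a $ ?t i)"
        by (simp add: content_cbox_cart)
      also have "\<dots> = (\<Prod>i\<in>UNIV. b $ i - a $ i)"
        using prod.permute[OF permutes_swap_id[of m UNIV n], of "\<lambda>i. b $ i - a $ i"] by (simp add: o_def)
      finally show "measure lebesgue (?h ` cbox a b) = measure lebesgue (cbox a b)"
        using ne by (simp add: content_cbox_cart)
    qed
  next
    fix m n :: 'n assume mn: "m \<noteq> n"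
    let ?h = "\<lambda>x::real^'n. \<chi> i. if i = m then x $ m + x $ n else x $ i"
    have lin: "linear ?h" by (rule linearI) (simp_all add: vec_eq_iff algebra_simps)
    have "matrix ?h = (\<chi> i. if i = m then row m (mat 1) + 1 *s row n (mat 1) else row i (mat 1))"
      by (simp add: matrix_def mat_def axis_def row_def vec_eq_iff)
    then have "\<bar>det (matrix ?h)\<bar> = 1" using det_row_operation[OF mn, of "mat 1 :: real^'n^'n" 1] by simp
    then show "?Q ?h"
    proof (rule suff[OF lin])
      fix a b :: "real^'n" assume ne: "cbox a b \<noteq> {}"
      \<comment> \<open>\<open>measure_shear_interval\<close> wants a nonnegative lower corner, so
        the box is first translated to start at \<open>0\<close>.\<close>
      have cb: "cbox a b = (+) a ` cbox 0 (b - a)" using cbox_translation[of a 0 "b - a"] by simp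
      have "?h ` cbox a b = (+) (?h a) ` ?h ` cbox 0 (b - a)"
        unfolding cb image_comp by (intro image_cong refl) (simp add: vec_eq_iff)
      then have "measure lebesgue (?h ` cbox a b) = measure lebesgue (?h ` cbox 0 (b - a))"
        by (simp add: measure_translation)
      also have "\<dots> = measure lebesgue (cbox 0 (b - a))"
        by (rule measure_shear_interval[OF mn]) (use ne cb in auto)
      also have "\<dots> = measure lebesgue (cbox a b)" unfolding cb by (simp only: measure_translation)
      finally show "measure lebesgue (?h ` cbox a b) = measure lebesgue (cbox a b)" .
    qed
  qed
  then show ?thesis using assms(2) by blast
qed

text \<open>Planar areas are measured as volumes of prisms over unit intervals, so that they can
  enter the lattice packing in \<open>real^'n\<close> directly.\<close>

definition prism :: "'n \<Rightarrow> 'n \<Rightarrow> (real \<times> real) set \<Rightarrow> (real^'n) set" where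
  "prism a b T = {x. (x $ a, x $ b) \<in> T \<and> (\<forall>i. i \<noteq> a \<and> i \<noteq> b \<longrightarrow> 0 < x $ i \<and> x $ i < 1)}"

lemma prism_mono: "S \<subseteq> T \<Longrightarrow> prism a b S \<subseteq> prism a b T"
  by (auto simp: prism_def)

lemma bounded_prism:
  assumes "bounded T"
  shows "bounded (prism a b T :: (real^'n) set)"
proof -
  obtain B where B: "\<And>p. p \<in> T \<Longrightarrow> norm p \<le> B" using assms by (auto simp: bounded_iff)
  have "\<bar>x $ i\<bar> \<le> max B 1" if x: "x \<in> prism a b T" for x :: "real^'n" and i
  proof -
    have "norm (x $ a, x $ b) \<le> B" using x B by (auto simp: prism_def)
    then have "\<bar>x $ a\<bar> \<le> B" "\<bar>x $ b\<bar> \<le> B"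
      using norm_fst_le[of "x $ a" "x $ b"] norm_snd_le[of "x $ b" "x $ a"] by auto
    then show ?thesis using x by (cases "i = a \<or> i = b") (fastforce simp: prism_def)+
  qed
  then have "prism a b T \<subseteq> cbox (\<chi> i. - max B 1) (\<chi> i. max B 1)"
    by (auto simp: mem_box_cart abs_le_iff simp del: max_def) (smt (verit))+
  then show ?thesis using bounded_cbox bounded_subset by blast
qed

lemma open_prism:
  assumes "open T"
  shows "open (prism a b T :: (real^'n) set)"
proof -
  have "prism a b T = (\<lambda>x::real^'n. (x $ a, x $ b)) -` T
      \<inter> (\<Inter>i\<in>-{a, b}. {x. 0 < x $ i} \<inter> {x. x $ i < 1})"
    by (auto simp: prism_def)
  moreover have "open ((\<lambda>x::real^'n. (x $ a, x $ b)) -` T)"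
    by (intro open_vimage assms continuous_intros)
  moreover have "open (\<Inter>i\<in>-{a, b}. {x::real^'n. 0 < x $ i} \<inter> {x. x $ i < 1})"
    by (intro open_INT open_Int open_Collect_less continuous_intros ballI) auto
  ultimately show ?thesis by auto
qed

lemma lmeasurable_prism:
  "open T \<Longrightarrow> bounded T \<Longrightarrow> (prism a b T :: (real^'n) set) \<in> lmeasurable"
  by (simp add: bounded_prism lmeasurable_open open_prism)

text \<open>Acting as \<open>L\<close> on the coordinates \<open>a\<close>, \<open>b\<close> and as
  the identity elsewhere maps one prism onto the other. The matrix \<open>N\<close> of this map is
  the identity with two rows replaced, so \<open>det_replace_two_rows\<close> applies.\<close>

lemma measure_prism_linear_image:
  fixes a b :: "'n::finite" and p q r s :: real
  assumes ab: "a \<noteq> b" and T: "(prism a b T :: (real^'n) set) \<in> lmeasurable"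
  defines "L \<equiv> (\<lambda>(x, y). (p * x + r * y, q * x + s * y))"
  shows "measure lebesgue (prism a b (L ` T) :: (real^'n) set)
       = \<bar>p * s - q * r\<bar> * measure lebesgue (prism a b T :: (real^'n) set)"
proof -
  define \<kappa> where "\<kappa> j = (if j = a then p else if j = b then r else 0)" for j
  define \<kappa>' where "\<kappa>' j = (if j = a then q else if j = b then s else 0)" for j
  let ?I = "mat 1 :: real^'n^'n"
  define N where "N = (\<chi> i. if i = a then \<Sum>j\<in>UNIV. \<kappa> j *s ?I $ j
                else if i = b then \<Sum>j\<in>UNIV. \<kappa>' j *s ?I $ j else ?I $ i)"
  have comb: "(\<Sum>j\<in>UNIV. f j *s ?I $ j) $ k = f k" for f :: "'n \<Rightarrow> real" and k
    by (simp add: mat_def if_distrib[of "\<lambda>x. _ * x"] cong: if_cong)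
  have two: "(\<Sum>j\<in>UNIV. (if j = a then u else if j = b then v else 0) * x $ j) = u * x $ a + v * x $ b"
    for u v :: real and x :: "real^'n"
  proof -
    have "(\<Sum>j\<in>UNIV. (if j = a then u else if j = b then v else 0) * x $ j)
        = (\<Sum>j\<in>UNIV. (if j = a then u * x $ a else 0) + (if j = b then v * x $ b else 0))"
      using ab by (intro sum.cong) auto
    then show ?thesis by (simp add: sum.distrib)
  qed
  have Nx: "(N *v x) $ i = (if i = a then p * x $ a + r * x $ b
      else if i = b then q * x $ a + s * x $ b else x $ i)" for x i
  proof -
    have "(N *v x) $ i = (\<Sum>j\<in>UNIV. N $ i $ j * x $ j)"
      by (simp add: matrix_vector_mult_def)
    moreover have "N $ i $ j = (if i = a then \<kappa> j else if i = b then \<kappa>' j else ?I $ i $ j)" for j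
      by (simp add: N_def comb del: sum_component)
    moreover have "(\<Sum>j\<in>UNIV. ?I $ i $ j * x $ j) = x $ i"
      by (simp add: mat_def if_distrib[of "\<lambda>x. x * _"] cong: if_cong)
    ultimately show ?thesis by (simp add: \<kappa>_def \<kappa>'_def two)
  qed
  have "prism a b (L ` T) = (*v) N ` prism a b T"
  proof (intro equalityI subsetI)
    fix z :: "real^'n" assume z: "z \<in> prism a b (L ` T)"
    then obtain u v where uv: "(u, v) \<in> T" "z $ a = p * u + r * v" "z $ b = q * u + s * v"
      by (auto simp: prism_def L_def)
    let ?x = "\<chi> i. if i = a then u else if i = b then v else z $ i"
    have "z = N *v ?x" using ab uv by (auto simp: vec_eq_iff Nx)
    moreover have "?x \<in> prism a b T" using ab uv z by (auto simp: prism_def)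
    ultimately show "z \<in> (*v) N ` prism a b T" by blast
  next
    fix z assume "z \<in> (*v) N ` prism a b T"
    then obtain x where x: "z = N *v x" "x \<in> prism a b T" by blast
    have "(z $ a, z $ b) = L (x $ a, x $ b)" using ab by (simp add: x(1) Nx L_def)
    moreover have "L (x $ a, x $ b) \<in> L ` T" using x(2) by (intro imageI) (simp add: prism_def)
    moreover have "z $ i = x $ i" if "i \<noteq> a" "i \<noteq> b" for i using that by (simp add: x(1) Nx)
    ultimately show "z \<in> prism a b (L ` T)" using x(2) by (simp add: prism_def)
  qed
  moreover have "det N = (p * s - q * r) * det ?I"
    unfolding N_def det_replace_two_rows[OF ab] using ab by (simp add: \<kappa>_def \<kappa>'_def mult.commute)
  ultimately show ?thesis
    using linear_image_lebesgue_cart[OF matrix_vector_mul_linear[of N] T]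
    by (simp add: matrix_of_matrix_vector_mul)
qed

section \<open>The area of a polar polygon\<close>

definition cross2 :: "real \<times> real \<Rightarrow> real \<times> real \<Rightarrow> real" where
  "cross2 P Q = fst P * snd Q - snd P * fst Q"

text \<open>Since \<open>g \<bullet> rot2 u = cross2 u g\<close>, bounding all cross products in
  \<open>G\<close> by \<open>1\<close> says that the rotated members of \<open>G\<close> lie in the
  polar of \<open>G\<close>.\<close>

definition rot2 :: "real \<times> real \<Rightarrow> real \<times> real" where
  "rot2 P = (- snd P, fst P)"

definition sector :: "real \<times> real \<Rightarrow> real \<times> real \<Rightarrow> (real \<times> real) set" where
  "sector P Q = {y. 0 < cross2 P y \<and> 0 < cross2 y Q}"

text \<open>With the bound \<open>1/2\<close> and symmetric \<open>G\<close>, any two points satisfy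
  \<open>\<bar>g \<bullet> (y - y')\<bar> < 1\<close>, as the packing argument requires.\<close>

definition half_polar :: "(real \<times> real) set \<Rightarrow> (real \<times> real) set" where
  "half_polar G = {y. \<forall>g\<in>G. g \<bullet> y < 1/2}"

section \<open>Cross products and sectors in the plane\<close>

lemma inner2: "(P :: real \<times> real) \<bullet> Q = fst P * fst Q + snd P * snd Q"
  by (simp add: inner_prod_def)

lemma open_sector: "open (sector P Q)"
  unfolding sector_def cross2_def
  by (intro open_Collect_conj open_Collect_less continuous_intros)

lemma open_half_polar: "finite G \<Longrightarrow> open (half_polar G)"
proof -
  assume "finite G"
  have "half_polar G = (\<Inter>g\<in>G. {y. g \<bullet> y < 1/2})" by (auto simp: half_polar_def)
  then show ?thesis using \<open>finite G\<close> by (auto intro!: open_Collect_less continuous_intros)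
qed

lemma half_polar_bounded:
  assumes "(1, 0) \<in> G" "(0, 1) \<in> G" "\<And>g. g \<in> G \<Longrightarrow> - g \<in> G"
  shows "bounded (half_polar G)"
proof -
  have "norm y \<le> 1" if y: "y \<in> half_polar G" for y
  proof -
    have "g \<bullet> y < 1/2 \<and> - g \<bullet> y < 1/2" if "g \<in> G" for g
      using y assms(3)[OF that] that unfolding half_polar_def by blast
    from this[OF assms(1)] this[OF assms(2)] have "\<bar>fst y\<bar> < 1/2" "\<bar>snd y\<bar> < 1/2"
      by (auto simp: inner2)
    then show ?thesis using norm_Pair_le[of "fst y" "snd y"] by simp
  qed
  then show ?thesis unfolding bounded_iff by blast
qed

lemma sector_combination:
  assumes "cross2 P Q \<noteq> 0"
  shows "R = (cross2 R Q / cross2 P Q) *\<^sub>R P + (cross2 P R / cross2 P Q) *\<^sub>R Q"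
proof -
  have "cross2 P Q *\<^sub>R R = cross2 R Q *\<^sub>R P + cross2 P R *\<^sub>R Q"
    by (simp add: prod_eq_iff cross2_def algebra_simps)
  then have "(1 / cross2 P Q) *\<^sub>R (cross2 P Q *\<^sub>R R) = (1 / cross2 P Q) *\<^sub>R (cross2 R Q *\<^sub>R P + cross2 P R *\<^sub>R Q)"
    by simp
  then show ?thesis using assms by (simp add: scaleR_add_right)
qed

lemma cross2_add_right: "cross2 P (Q + R) = cross2 P Q + cross2 P R"
  and cross2_scale_right: "cross2 P (c *\<^sub>R Q) = c * cross2 P Q"
  and cross2_add_left: "cross2 (P + Q) R = cross2 P R + cross2 Q R"
  and cross2_scale_left: "cross2 (c *\<^sub>R P) Q = c * cross2 P Q"
  and cross2_self: "cross2 P P = 0"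
  and cross2_swap: "cross2 Q P = - cross2 P Q"
  and cross2_rot2: "cross2 (rot2 P) (rot2 Q) = cross2 P Q"
  and inner_rot2: "P \<bullet> rot2 Q = cross2 Q P"
  and cross2_rot2_right: "cross2 P (rot2 Q) = P \<bullet> Q"
  by (simp_all add: cross2_def rot2_def inner2 algebra_simps)

lemma sector_subset_left:
  assumes "0 < cross2 P Q" "0 \<le> cross2 Q R" "0 < cross2 P R"
  shows "sector P Q \<subseteq> sector P R"
proof
  fix y assume y: "y \<in> sector P Q"
  have "cross2 y R = cross2 y Q / cross2 P Q * cross2 P R + cross2 P y / cross2 P Q * cross2 Q R"
    using assms(1) by (subst sector_combination[of P Q y]) (simp_all add: cross2_add_left cross2_scale_left)
  moreover have "0 < cross2 y Q / cross2 P Q * cross2 P R" "0 \<le> cross2 P y / cross2 P Q * cross2 Q R"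
    using y assms by (auto simp: sector_def)
  ultimately show "y \<in> sector P R" using y by (auto simp: sector_def)
qed

lemma sector_subset_right:
  assumes "0 \<le> cross2 P Q" "0 < cross2 Q R" "0 < cross2 P R"
  shows "sector Q R \<subseteq> sector P R"
proof
  fix y assume y: "y \<in> sector Q R"
  have "cross2 P y = cross2 y R / cross2 Q R * cross2 P Q + cross2 Q y / cross2 Q R * cross2 P R"
    using assms(2) by (subst sector_combination[of Q R y]) (simp_all add: cross2_add_right cross2_scale_right)
  moreover have "0 < cross2 Q y / cross2 Q R * cross2 P R" "0 \<le> cross2 y R / cross2 Q R * cross2 P Q"
    using y assms by (auto simp: sector_def)
  ultimately show "y \<in> sector P R" using y by (auto simp: sector_def)
qed

lemma sector_disjoint: "sector P Q \<inter> sector Q R = {}"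
proof -
  have "\<not> (0 < cross2 y Q \<and> 0 < cross2 Q y)" for y using cross2_swap[of Q y] by linarith
  then show ?thesis by (auto simp: sector_def)
qed

text \<open>Replacing \<open>P\<close> by \<open>P + s *\<^sub>R rot2 u\<close> adds
  \<open>s * (x + y - x * y)\<close> with \<open>(x, y) = u\<close>, and symmetrically for moving
  \<open>u\<close> along \<open>rot2 P\<close>. From \<open>P = u = (1, 0)\<close> to
  \<open>P = u = (0, 1)\<close> the value rises from \<open>-1\<close> to \<open>2\<close>.\<close>

definition sector_potential :: "real \<times> real \<Rightarrow> real \<times> real \<Rightarrow> real" where
  "sector_potential P u = snd u - fst u + snd P - fst P + fst u * fst P"

context
  fixes a b :: "'n::finite"
  assumes ab: "a \<noteq> b"
begin

abbreviation area :: "(real \<times> real) set \<Rightarrow> real" where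
  "area T \<equiv> measure lebesgue (prism a b T :: (real^'n) set)"

lemma area_mono:
  assumes "S \<subseteq> T" "open S" "open T" "bounded T"
  shows "area S \<le> area T"
  using assms by (intro measure_mono_fmeasurable prism_mono fmeasurableD lmeasurable_prism)
    (auto intro: bounded_subset)

lemma area_disjoint:
  assumes "S \<union> S' \<subseteq> T" "S \<inter> S' = {}" "open S" "open S'" "open T" "bounded T"
  shows "area S + area S' \<le> area T"
proof -
  have bd: "bounded S" "bounded S'" using assms bounded_subset by blast+
  have m: "(prism a b S :: (real^'n) set) \<in> lmeasurable" "(prism a b S' :: (real^'n) set) \<in> lmeasurable"
    by (intro lmeasurable_prism assms bd)+
  have "prism a b S \<inter> prism a b S' = ({} :: (real^'n) set)" using assms(2) by (auto simp: prism_def)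
  then have "area S + area S' = measure lebesgue (prism a b S \<union> prism a b S' :: (real^'n) set)"
    using measure_Union[OF _ _ fmeasurableD[OF m(1)] fmeasurableD[OF m(2)]]
      fmeasurableD2[OF m(1)] fmeasurableD2[OF m(2)]
    by (simp only: infinity_ennreal_def not_False_eq_True simp_thms)
  also have "prism a b S \<union> prism a b S' = (prism a b (S \<union> S') :: (real^'n) set)"
    by (auto simp: prism_def)
  also have "measure lebesgue \<dots> \<le> area T" by (rule area_mono) (use assms in auto)
  finally show ?thesis .
qed

lemma lmeasurable_prism_unit_triangle:
  "(prism a b {(s, t). 0 < s \<and> 0 < t \<and> s + t < 1} :: (real^'n) set) \<in> lmeasurable"
proof -
  have eq: "{(s, t). 0 < s \<and> 0 < t \<and> s + t < (1::real)} = {p. 0 < fst p \<and> 0 < snd p \<and> fst p + snd p < 1}"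
    by auto
  show ?thesis unfolding eq
    by (intro lmeasurable_prism bounded_subset[OF bounded_cbox[of "(0, 0)" "(1, 1)"]]
        open_Collect_conj open_Collect_less continuous_intros) (auto simp: cbox_Pair_eq)
qed

text \<open>Two shears carry the triangle to the two halves of the open unit square. Together with
  the negligible diagonal these cover the unit cube, so twice the area is at least
  \<open>1\<close>.\<close>

lemma area_unit_triangle:
  "1/2 \<le> area {(s, t). 0 < s \<and> 0 < t \<and> s + t < 1}" (is "_ \<le> area ?T")
proof -
  let ?A = "(\<lambda>(x, y). (1 * x + 1 * y, 0 * x + 1 * y)) ` ?T" and ?B = "(\<lambda>(x, y). (1 * x + 0 * y, 1 * x + 1 * y)) ` ?T"
  note T = lmeasurable_prism_unit_triangle
  have A: "area ?A = area ?T" and B: "area ?B = area ?T"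
    using measure_prism_linear_image[OF ab T, of 1 1 0 1] measure_prism_linear_image[OF ab T, of 1 0 1 1] by simp_all
  have Aeq: "?A = {p. 0 < snd p \<and> snd p < fst p \<and> fst p < 1}"
  proof (intro equalityI subsetI)
    fix p :: "real \<times> real" assume "p \<in> {p. 0 < snd p \<and> snd p < fst p \<and> fst p < 1}"
    then show "p \<in> ?A" by (intro image_eqI[of _ _ "(fst p - snd p, snd p)"]) (auto simp: prod_eq_iff)
  qed auto
  have Beq: "?B = {p. 0 < fst p \<and> fst p < snd p \<and> snd p < 1}"
  proof (intro equalityI subsetI)
    fix p :: "real \<times> real" assume "p \<in> {p. 0 < fst p \<and> fst p < snd p \<and> snd p < 1}"
    then show "p \<in> ?B" by (intro image_eqI[of _ _ "(fst p, snd p - fst p)"]) (auto simp: prod_eq_iff)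
  qed auto
  have mA: "prism a b ?A \<in> lmeasurable" and mB: "prism a b ?B \<in> lmeasurable"
    unfolding Aeq Beq
    by (intro lmeasurable_prism bounded_subset[OF bounded_cbox[of "(0, 0)" "(1, 1)"]]
        open_Collect_conj open_Collect_less continuous_intros; auto simp: cbox_Pair_eq)+
  let ?H = "{x::real^'n. (axis a 1 - axis b 1) \<bullet> x = 0}"
  have "(axis a 1 - axis b 1 :: real^'n) \<noteq> 0" using ab by (metis axis_eq_axis eq_iff_diff_eq_0 zero_neq_one)
  then have neg: "negligible ?H" by (intro negligible_hyperplane) auto
  have sub: "box 0 (\<chi> i. 1) \<subseteq> (prism a b ?A \<union> prism a b ?B) \<union> ?H"
    unfolding Aeq Beq by (auto simp: prism_def mem_box_cart inner_diff_left inner_axis')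
  have "1 = measure lebesgue (box 0 (\<chi> i. 1) :: (real^'n) set)"
    by (auto simp: measure_lborel_box_eq Basis_vec_def inner_axis intro!: prod.neutral)
  also have "\<dots> \<le> measure lebesgue ((prism a b ?A \<union> prism a b ?B) \<union> ?H)"
    by (rule measure_mono_fmeasurable[OF sub]) (use mA mB neg in \<open>auto simp: negligible_iff_measure\<close>)
  also have "\<dots> \<le> area ?A + area ?B + measure lebesgue ?H"
    using mA mB neg by (intro order_trans[OF measure_Un_le] add_right_mono) (auto simp: negligible_iff_measure intro: measure_Un_le fmeasurableD)
  finally show ?thesis using A B neg by (simp add: negligible_iff_measure)
qed

text \<open>The open triangle with corners \<open>0\<close>, \<open>P / 2\<close>,
  \<open>Q / 2\<close> lies in the half polar. It is the image of the unit triangle under a map of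
  determinant \<open>cross2 P Q / 4\<close>.\<close>

lemma area_sector_ge:
  assumes fin: "finite G" and bdd: "bounded (half_polar G)"
    and P: "\<And>g. g \<in> G \<Longrightarrow> g \<bullet> P \<le> 1" and Q: "\<And>g. g \<in> G \<Longrightarrow> g \<bullet> Q \<le> 1"
    and pos: "0 < cross2 P Q"
  shows "cross2 P Q \<le> 8 * area (half_polar G \<inter> sector P Q)"
proof -
  let ?T = "{(s, t). 0 < s \<and> 0 < t \<and> s + t < (1::real)}"
  let ?L = "\<lambda>(x, y). (fst P / 2 * x + fst Q / 2 * y, snd P / 2 * x + snd Q / 2 * y)"
  have sub: "?L ` ?T \<subseteq> half_polar G \<inter> sector P Q"
  proof clarify
    fix s t :: real assume st: "0 < s" "0 < t" "s + t < 1"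
    let ?y = "(fst P / 2 * s + fst Q / 2 * t, snd P / 2 * s + snd Q / 2 * t)"
    have y: "?y = (s / 2) *\<^sub>R P + (t / 2) *\<^sub>R Q" by (simp add: prod_eq_iff mult.commute)
    have "g \<bullet> ?y < 1/2" if "g \<in> G" for g
    proof -
      have "s * (g \<bullet> P) \<le> s * 1" "t * (g \<bullet> Q) \<le> t * 1"
        using P[OF that] Q[OF that] st by (intro mult_left_mono; simp)+
      moreover have "g \<bullet> ?y = (s * (g \<bullet> P) + t * (g \<bullet> Q)) / 2"
        unfolding y by (simp add: inner_add_right)
      moreover have "s * (g \<bullet> P) + t * (g \<bullet> Q) < 1" using calculation(1,2) st(3) by linarith
      ultimately show ?thesis by simp
    qed
    moreover have "cross2 P ?y = t / 2 * cross2 P Q" "cross2 ?y Q = s / 2 * cross2 P Q"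
      unfolding y by (simp_all add: cross2_add_left cross2_add_right cross2_scale_left cross2_scale_right cross2_self)
    moreover have "0 < t / 2 * cross2 P Q" "0 < s / 2 * cross2 P Q" using st pos by simp_all
    ultimately show "?y \<in> half_polar G \<inter> sector P Q"
      unfolding half_polar_def sector_def Int_iff mem_Collect_eq by metis
  qed
  note T = lmeasurable_prism_unit_triangle
  have "\<bar>fst P / 2 * (snd Q / 2) - snd P / 2 * (fst Q / 2)\<bar> = cross2 P Q / 4"
    using pos by (simp add: cross2_def field_simps)
  then have eq: "area (?L ` ?T) = cross2 P Q / 4 * area ?T"
    using measure_prism_linear_image[OF ab T, of "fst P / 2" "fst Q / 2" "snd P / 2" "snd Q / 2"] by simp
  have "cross2 P Q / 4 * (1/2) \<le> cross2 P Q / 4 * area ?T"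
    using pos area_unit_triangle by (intro mult_left_mono) auto
  also have "\<dots> \<le> area (half_polar G \<inter> sector P Q)"
    unfolding eq[symmetric]
  \<comment> \<open>Nonmeasurable sets have \<open>measure\<close> zero by convention, so a nonzero
    value yields measurability of the image.\<close>
  proof (cases "area (?L ` ?T) = 0")
    case False
    show "area (?L ` ?T) \<le> area (half_polar G \<inter> sector P Q)"
    proof (rule measure_mono_fmeasurable[OF prism_mono[OF sub]])
      show "prism a b (?L ` ?T) \<in> sets lebesgue" using False measure_notin_sets by blast
      show "prism a b (half_polar G \<inter> sector P Q) \<in> lmeasurable"
        by (intro lmeasurable_prism open_Int open_half_polar fin open_sector)
           (use bdd bounded_subset in blast)
    qed
  qed simp
  finally show ?thesis by simp
qed


text \<open>With \<open>P\<close> on the boundary of the polygon \<open>{y. \<forall>g\<in>G. g \<bullet> y \<le> 1}\<close> and \<open>u \<in> G\<close> tight at \<open>P\<close>, move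
  the pair \<open>(P, u)\<close> along the boundary, alternately sliding \<open>P\<close> along an edge and turning \<open>u\<close> at a
  vertex. The potential grows by at most twice the area swept by \<open>P\<close> and by \<open>rot2 u\<close> together, because
  \<open>x + y - x * y \<le> 1\<close> on the unit square. The half-size polygon accounts for the factor \<open>8\<close>. If
  the lines of \<open>u\<close> and \<open>u'\<close> meet outside the polygon, the most violated \<open>w\<close> splits the sector.\<close>
lemma area_sector_pair_ge:
  assumes fin: "finite G" and sym: "\<And>g. g \<in> G \<Longrightarrow> - g \<in> G" and e: "(1, 0) \<in> G" "(0, 1) \<in> G"
    and cross: "\<And>g h. g \<in> G \<Longrightarrow> h \<in> G \<Longrightarrow> cross2 g h \<le> 1"
    and "\<And>g. g \<in> G \<Longrightarrow> g \<bullet> P \<le> 1" "\<And>g. g \<in> G \<Longrightarrow> g \<bullet> P' \<le> 1"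
    and "0 \<le> fst P" "0 \<le> snd P" "0 \<le> fst P'" "0 \<le> snd P'"
    and "u \<in> G" "u' \<in> G" "0 \<le> fst u" "0 \<le> snd u" "0 \<le> fst u'" "0 \<le> snd u'"
    and "u \<bullet> P = 1" "u' \<bullet> P' = 1" "0 < cross2 u u'" "0 < cross2 P P'"
  shows "sector_potential P' u' - sector_potential P u
    \<le> 8 * area (half_polar G \<inter> sector P P') + 8 * area (half_polar G \<inter> sector (rot2 u) (rot2 u'))"
  using assms(6-)
\<comment> \<open>The point in the measure is where the lines of \<open>u\<close> and
  \<open>u'\<close> meet, called \<open>Q\<close> below; the induction counts the members of
  \<open>G\<close> violated there.\<close>
proof (induction "card {g\<in>G. 1 < g \<bullet> (P + ((1 - u' \<bullet> P) / cross2 u u') *\<^sub>R rot2 u)}"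
    arbitrary: P P' u u' rule: less_induct)
  case less
  note P = less.prems(1) and P' = less.prems(2) and Pn = less.prems(3,4) and P'n = less.prems(5,6)
    and uG = less.prems(7,8) and un = less.prems(9-12) and uP = less.prems(13,14)
    and uu = less.prems(15) and PP = less.prems(16)
  have bdd: "bounded (half_polar G)" by (rule half_polar_bounded[OF e sym])
  have opn: "open (half_polar G \<inter> sector X Y)" for X Y
    by (intro open_Int open_half_polar fin open_sector)
  have bd: "bounded (half_polar G \<inter> sector X Y)" for X Y using bdd bounded_subset by blast
  have G1: "g \<bullet> rot2 h \<le> 1" if "g \<in> G" "h \<in> G" for g h
    using cross[OF that(2,1)] by (simp add: inner_rot2)
  have coord: "fst g \<le> 1" "snd g \<le> 1" if "g \<in> G" for g
    using cross[OF that e(2)] cross[OF e(1) that] by (auto simp: cross2_def)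
  \<comment> \<open>\<open>P\<close> slides along the line of \<open>u\<close> by \<open>s\<close>
    to \<open>Q\<close>, and from there along the line of \<open>u'\<close> by \<open>s'\<close> to
    \<open>P'\<close>. As these lines are at level \<open>1\<close>, \<open>s = cross2 P Q\<close>
    and \<open>s' = cross2 Q P'\<close>.\<close>
  define s where "s = (1 - u' \<bullet> P) / cross2 u u'"
  define s' where "s' = (1 - u \<bullet> P') / cross2 u u'"
  define Q where "Q = P + s *\<^sub>R rot2 u"
  have s: "0 \<le> s" "0 \<le> s'" using P[OF uG(2)] P'[OF uG(1)] uu by (auto simp: s_def s'_def)
  have uQ: "u \<bullet> Q = 1" using uP(1) by (simp add: Q_def inner_add_right inner_rot2 cross2_self)
  have u'Q: "u' \<bullet> Q = 1" using uu by (simp add: Q_def inner_add_right inner_rot2 s_def)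
  have Q': "P' = Q + s' *\<^sub>R rot2 u'"
  proof -
    let ?d = "P' - (Q + s' *\<^sub>R rot2 u')"
    have "u \<bullet> ?d = 0" "u' \<bullet> ?d = 0"
      using uQ u'Q uP(2) uu
      by (simp_all add: inner_diff_right inner_add_right inner_rot2 cross2_self s'_def cross2_swap[of u' u])
    then have "cross2 u u' * fst ?d = 0" "cross2 u u' * snd ?d = 0"
      unfolding inner2 cross2_def by algebra+
    then show ?thesis using uu by (simp add: prod_eq_iff)
  qed
  have PQ: "cross2 P Q = s"
    using uP(1) by (simp add: Q_def cross2_add_right cross2_scale_right cross2_self cross2_rot2_right inner_commute)
  have QP': "cross2 Q P' = s'"
    using u'Q by (simp add: Q' cross2_add_right cross2_scale_right cross2_self cross2_rot2_right inner_commute)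
  have nonneg_between: "0 \<le> fst R \<and> 0 \<le> snd R"
    if "0 \<le> cross2 X R" "0 \<le> cross2 R Y" "0 < cross2 X Y" "0 \<le> fst X" "0 \<le> snd X" "0 \<le> fst Y" "0 \<le> snd Y" for R X Y
    using that by (subst (1 2) sector_combination[of X Y R]) auto
  have Qn: "0 \<le> fst Q" "0 \<le> snd Q"
    using nonneg_between[of P Q P'] PQ QP' s PP Pn P'n by auto
  show ?case
  proof (cases "{g\<in>G. 1 < g \<bullet> Q} = {}")
    \<comment> \<open>Here \<open>Q\<close> is in the polygon: slide \<open>P\<close> to
      \<open>Q\<close>, turn \<open>u\<close> to \<open>u'\<close> there, and slide on to
      \<open>P'\<close>. Slides of length \<open>0\<close> are treated apart because their sectors
      degenerate.\<close>
    case True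
    then have Q1: "g \<bullet> Q \<le> 1" if "g \<in> G" for g using that not_less by blast
    have "s + s' \<le> 8 * area (half_polar G \<inter> sector P P')"
    proof -
      have 1: "s \<le> 8 * area (half_polar G \<inter> sector P Q)" 
        using area_sector_ge[OF fin bdd P Q1] PQ s by (cases "s = 0") auto
      have 2: "s' \<le> 8 * area (half_polar G \<inter> sector Q P')" 
        using area_sector_ge[OF fin bdd Q1 P'] QP' s by (cases "s' = 0") auto
      consider "s = 0" | "s' = 0" | "0 < s" "0 < s'" using s by linarith
      then show ?thesis
      proof cases
        assume "s = 0"
        then have "Q = P" by (simp add: Q_def)
        then show ?thesis using 2 \<open>s = 0\<close> by simp
      next
        assume "s' = 0"
        then have "Q = P'" by (simp add: Q')
        then show ?thesis using 1 \<open>s' = 0\<close> by simp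
      next
        assume "0 < s" "0 < s'"
        then have "sector P Q \<subseteq> sector P P'" "sector Q P' \<subseteq> sector P P'"
          using sector_subset_left[of P Q P'] sector_subset_right[of P Q P'] PQ QP' PP by auto
        then have "area (half_polar G \<inter> sector P Q) + area (half_polar G \<inter> sector Q P')
            \<le> area (half_polar G \<inter> sector P P')"
          using sector_disjoint[of P Q P'] by (intro area_disjoint opn bd) blast+
        then show ?thesis using 1 2 by simp
      qed
    qed
    moreover have "cross2 u u' \<le> 8 * area (half_polar G \<inter> sector (rot2 u) (rot2 u'))"
      using area_sector_ge[OF fin bdd, of "rot2 u" "rot2 u'"] G1 uG uu by (simp add: cross2_rot2)
    moreover have "sector_potential P' u' - sector_potential P u \<le> s + s' + cross2 u u'"
    proof -
      \<comment> \<open>\<open>(1 - x) * (1 - y)\<close> is \<open>1 - (x + y - x * y)\<close>; its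
        sign bounds each of the three increments of the potential by the length of the move.\<close>
      have unit: "0 \<le> (1 - fst v) * (1 - snd v)" if "fst v \<le> 1" "snd v \<le> 1" for v :: "real \<times> real"
        using that by simp
      have "fst Q \<le> 1" "snd Q \<le> 1" using Q1[OF e(1)] Q1[OF e(2)] by (auto simp: inner2)
      then have "0 \<le> cross2 u u' * ((1 - fst Q) * (1 - snd Q))" using unit uu by simp
      moreover have "0 \<le> s * ((1 - fst u) * (1 - snd u))" "0 \<le> s' * ((1 - fst u') * (1 - snd u'))"
        using unit coord uG s by simp_all
      \<comment> \<open>Both \<open>u\<close> and \<open>u'\<close> are tight at \<open>Q\<close>,
        so their difference is a multiple of \<open>rot2 Q\<close>.\<close>
      moreover have u': "u' = u + cross2 u u' *\<^sub>R rot2 Q"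
        using uQ u'Q unfolding prod_eq_iff cross2_def rot2_def inner2 by simp algebra
      have "sector_potential Q u - sector_potential P u = s * (fst u + snd u - fst u * snd u)"
        by (simp add: sector_potential_def Q_def rot2_def algebra_simps)
      moreover have "sector_potential Q u' - sector_potential Q u
          = cross2 u u' * (fst Q + snd Q - fst Q * snd Q)"
        by (subst (1) u') (simp add: sector_potential_def rot2_def algebra_simps)
      moreover have "sector_potential P' u' - sector_potential Q u' = s' * (fst u' + snd u' - fst u' * snd u')"
        by (simp add: sector_potential_def Q' rot2_def algebra_simps)
      ultimately show ?thesis by (simp add: algebra_simps)
    qed
    ultimately show ?thesis by linarith
  next
    case False
    let ?V = "\<lambda>Q. {g\<in>G. 1 < g \<bullet> Q}"
    obtain w where w: "w \<in> G" "\<And>g. g \<in> G \<Longrightarrow> g \<bullet> Q \<le> w \<bullet> Q"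
      using ex_is_arg_min_if_finite[OF fin, of "\<lambda>g. - (g \<bullet> Q)"] e(1) by (auto simp: is_arg_min_linorder)
    then have wQ: "1 < w \<bullet> Q" using False by force
    \<comment> \<open>Scaling \<open>Q\<close> back to the boundary makes \<open>w\<close> tight at
      \<open>R\<close>, so \<open>(R, w)\<close> is an admissible pair between \<open>(P, u)\<close>
      and \<open>(P', u')\<close>.\<close>
    define R where "R = (1 / (w \<bullet> Q)) *\<^sub>R Q"
    have R1: "g \<bullet> R \<le> 1" if "g \<in> G" for g using w(2)[OF that] wQ by (simp add: R_def)
    have wR: "w \<bullet> R = 1" using wQ by (simp add: R_def)
    have Rn: "0 \<le> fst R" "0 \<le> snd R" using Qn wQ by (auto simp: R_def)
    have "0 < s * cross2 u w"
      using P[OF w(1)] wQ by (simp add: Q_def inner_add_right inner_rot2)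
    then have uw: "0 < cross2 u w" and s0: "0 < s" using s(1) by (auto simp: zero_less_mult_iff)
    have "0 < s' * cross2 w u'"
      using P'[OF w(1)] wQ by (simp add: Q' inner_add_right inner_rot2 cross2_swap[of w u'])
    then have wu': "0 < cross2 w u'" and s'0: "0 < s'" using s(2) by (auto simp: zero_less_mult_iff)
    have PR: "0 < cross2 P R" and RP': "0 < cross2 R P'"
      using PQ QP' s0 s'0 wQ by (simp_all add: R_def cross2_scale_left cross2_scale_right)
    have wn: "0 \<le> fst w" "0 \<le> snd w" using nonneg_between[of u w u'] uw wu' uu un by auto
    define s1 where "s1 = (1 - w \<bullet> P) / cross2 u w"
    define s2 where "s2 = (1 - u' \<bullet> R) / cross2 w u'"
    let ?Q1 = "P + s1 *\<^sub>R rot2 u" and ?Q2 = "R + s2 *\<^sub>R rot2 w"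
    have finV: "finite (?V Q)" using fin by simp
    have wV: "w \<in> ?V Q" using w(1) wQ by simp
    have w1: "w \<bullet> ?Q1 = 1" using uw by (simp add: s1_def inner_add_right inner_rot2)
    \<comment> \<open>\<open>?Q1\<close>, where the lines of \<open>u\<close> and \<open>w\<close>
      meet, is on the segment from \<open>P\<close> to \<open>Q\<close>. A member of
      \<open>G\<close> violated at \<open>?Q1\<close> holds at \<open>P\<close>, so it grows along
      the segment and is violated at \<open>Q\<close>. In turn \<open>w\<close> is tight at
      \<open>?Q1\<close>.\<close>
    have "?V ?Q1 \<subset> ?V Q"
    proof -
      have s1: "0 \<le> s1" "s1 \<le> s"
      proof -
        show "0 \<le> s1" using P[OF w(1)] uw by (simp add: s1_def)
        have "1 - w \<bullet> P \<le> s * cross2 u w" using wQ by (simp add: Q_def inner_add_right inner_rot2)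
        then show "s1 \<le> s" using uw by (simp add: s1_def pos_divide_le_eq)
      qed
      have "1 < g \<bullet> Q" if "g \<in> G" "1 < g \<bullet> ?Q1" for g
      proof -
        have *: "1 < g \<bullet> P + s1 * cross2 u g" using that(2) by (simp add: inner_add_right inner_rot2)
        then have "0 < s1 * cross2 u g" using P[OF that(1)] by linarith
        then have "0 < cross2 u g" using s1(1) by (simp add: zero_less_mult_iff)
        then have "s1 * cross2 u g \<le> s * cross2 u g" using s1(2) by (intro mult_right_mono) auto
        then show ?thesis using * by (simp add: Q_def inner_add_right inner_rot2)
      qed
      moreover have "w \<notin> ?V ?Q1" using w1 by simp
      ultimately show ?thesis using wV by blast
    qed
    then have c1: "card (?V ?Q1) < card (?V Q)" using finV psubset_card_mono by blast
    have Q2: "w \<bullet> ?Q2 = 1" "u' \<bullet> ?Q2 = 1"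
      using wu' wR by (simp_all add: s2_def inner_add_right inner_rot2 cross2_self)
    have "?V ?Q2 \<subset> ?V Q"
    proof -
      define t where "t = (1 - w \<bullet> P') / cross2 w u'"
      have t: "0 \<le> t" "t \<le> s'"
      proof -
        show "0 \<le> t" using P'[OF w(1)] wu' by (simp add: t_def)
        have "1 - w \<bullet> P' \<le> s' * cross2 w u'"
          using wQ by (simp add: Q' inner_add_right inner_rot2 cross2_swap[of w u'])
        then show "t \<le> s'" using wu' by (simp add: t_def pos_divide_le_eq)
      qed
      \<comment> \<open>The mirror image: \<open>?Q2\<close> lies on the segment from
        \<open>P'\<close> back to \<open>Q\<close>.\<close>
      have Q2t: "?Q2 = P' - t *\<^sub>R rot2 u'"
      proof -
        let ?d = "?Q2 - (P' - t *\<^sub>R rot2 u')"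
        have "g \<bullet> ?d = g \<bullet> ?Q2 - (g \<bullet> P' - t * cross2 u' g)" for g
          by (simp only: inner_diff_right inner_scaleR_right inner_rot2)
        then have "w \<bullet> ?d = 0" "u' \<bullet> ?d = 0"
          using Q2 uP(2) wu' by (simp_all add: cross2_self t_def cross2_swap[of w u'])
        then have "cross2 w u' * fst ?d = 0" "cross2 w u' * snd ?d = 0"
          unfolding inner2 cross2_def by algebra+
        then show ?thesis using wu' by (simp add: prod_eq_iff)
      qed
      have Qt: "Q = P' - s' *\<^sub>R rot2 u'" by (simp add: Q')
      have "1 < g \<bullet> Q" if "g \<in> G" "1 < g \<bullet> ?Q2" for g
      proof -
        have *: "1 < g \<bullet> P' + t * cross2 g u'"
          using that(2) unfolding Q2t by (simp add: inner_diff_right inner_rot2 cross2_swap[of g u'])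
        then have "0 < t * cross2 g u'" using P'[OF that(1)] by linarith
        then have "0 < cross2 g u'" using t(1) by (simp add: zero_less_mult_iff)
        then have "t * cross2 g u' \<le> s' * cross2 g u'" using t(2) by (intro mult_right_mono) auto
        then show ?thesis using * unfolding Qt by (simp add: inner_diff_right inner_rot2 cross2_swap[of g u'])
      qed
      moreover have "w \<notin> ?V ?Q2" using Q2 by simp
      ultimately show ?thesis using wV by blast
    qed
    then have c2: "card (?V ?Q2) < card (?V Q)" using finV psubset_card_mono by blast
    have "sector_potential R w - sector_potential P u
      \<le> 8 * area (half_polar G \<inter> sector P R) + 8 * area (half_polar G \<inter> sector (rot2 u) (rot2 w))"
      by (rule less.hyps[OF c1[unfolded s1_def Q_def s_def]])
         (use P R1 Pn Rn uG w(1) un wn uP wR uw PR in auto)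
    moreover have "sector_potential P' u' - sector_potential R w
      \<le> 8 * area (half_polar G \<inter> sector R P') + 8 * area (half_polar G \<inter> sector (rot2 w) (rot2 u'))"
      by (rule less.hyps[OF c2[unfolded s2_def Q_def s_def]])
         (use P' R1 P'n Rn uG w(1) un wn uP wR wu' RP' in auto)
    moreover have "area (half_polar G \<inter> sector P R) + area (half_polar G \<inter> sector R P')
        \<le> area (half_polar G \<inter> sector P P')"
      using sector_disjoint[of P R P'] sector_subset_left[of P R P'] sector_subset_right[of P R P'] PR RP' PP
      by (intro area_disjoint opn bd) (auto simp: less_imp_le)
    moreover have "area (half_polar G \<inter> sector (rot2 u) (rot2 w)) + area (half_polar G \<inter> sector (rot2 w) (rot2 u'))
        \<le> area (half_polar G \<inter> sector (rot2 u) (rot2 u'))"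
      using sector_disjoint[of "rot2 u" "rot2 w" "rot2 u'"] uw wu' uu
        sector_subset_left[of "rot2 u" "rot2 w" "rot2 u'"] sector_subset_right[of "rot2 u" "rot2 w" "rot2 u'"]
      by (intro area_disjoint opn bd) (auto simp: less_imp_le cross2_rot2)
    ultimately show ?thesis by linarith
  qed
qed

text \<open>Between the pairs \<open>(?e1, ?e1)\<close> and \<open>(?e2, ?e2)\<close> the potential
  rises by \<open>3\<close>. The two sectors swept are the first and second quadrants, so the upper
  half has area at least \<open>3/8\<close>; central symmetry doubles it.\<close>

lemma area_half_polar_ge:
  assumes fin: "finite G" and sym: "\<And>g. g \<in> G \<Longrightarrow> - g \<in> G" and e: "(1, 0) \<in> G" "(0, 1) \<in> G"
    and cross: "\<And>g h. g \<in> G \<Longrightarrow> h \<in> G \<Longrightarrow> cross2 g h \<le> 1"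
  shows "3/4 \<le> area (half_polar G)"
proof -
  have bdd: "bounded (half_polar G)" by (rule half_polar_bounded[OF e sym])
  let ?K = "half_polar G"
  let ?e1 = "(1, 0) :: real \<times> real" and ?e2 = "(0, 1) :: real \<times> real"
  have opn: "open (?K \<inter> S)" if "open S" for S
    using that fin by (intro open_Int open_half_polar)
  have bd: "bounded (?K \<inter> S)" for S using bdd bounded_subset by blast
  have coord: "fst g \<le> 1" "snd g \<le> 1" if "g \<in> G" for g
    using cross[OF that e(2)] cross[OF e(1) that] by (auto simp: cross2_def)
  have "sector_potential ?e2 ?e2 - sector_potential ?e1 ?e1
    \<le> 8 * area (?K \<inter> sector ?e1 ?e2) + 8 * area (?K \<inter> sector (rot2 ?e1) (rot2 ?e2))"
    by (rule area_sector_pair_ge) (use assms coord in \<open>auto simp: inner2 cross2_def\<close>)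
  moreover have "area (?K \<inter> sector ?e1 ?e2) + area (?K \<inter> sector (rot2 ?e1) (rot2 ?e2)) \<le> area (?K \<inter> {y. 0 < snd y})"
    by (intro area_disjoint opn bd open_sector open_Collect_less continuous_intros)
       (auto simp: sector_def cross2_def rot2_def)
  ultimately have upper: "3/8 \<le> area (?K \<inter> {y. 0 < snd y})"
    by (simp add: sector_potential_def)
  have "(\<lambda>(x, y). (-1 * x + 0 * y, 0 * x + -1 * y)) ` (?K \<inter> {y. 0 < snd y}) = ?K \<inter> {y. snd y < 0}"
  proof -
    have neg: "- y \<in> ?K" if "y \<in> ?K" for y
    proof -
      have "- g \<bullet> y < 1/2" if "g \<in> G" for g using \<open>y \<in> ?K\<close> sym[OF that] unfolding half_polar_def by blast
      then show ?thesis by (simp add: half_polar_def)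
    qed
    have "(\<lambda>(x, y). (-1 * x + 0 * y, 0 * x + -1 * y)) = (uminus :: real \<times> real \<Rightarrow> _)"
      by (auto simp: fun_eq_iff)
    moreover have "uminus ` (?K \<inter> {y. 0 < snd y}) = ?K \<inter> {y. snd y < 0}"
      using neg by (auto intro!: image_eqI[of _ uminus "- _"]) 
    ultimately show ?thesis by simp
  qed
  then have "area (?K \<inter> {y. snd y < 0}) = area (?K \<inter> {y. 0 < snd y})"
    using measure_prism_linear_image[OF ab, of "?K \<inter> {y. 0 < snd y}" "-1" 0 0 "-1"]
      lmeasurable_prism[OF opn bd, of "{y. 0 < snd y}" a b]
    by (simp add: open_Collect_less continuous_on_snd continuous_on_const continuous_on_id)
  moreover have "area (?K \<inter> {y. 0 < snd y}) + area (?K \<inter> {y. snd y < 0}) \<le> area ?K"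
    by (rule area_disjoint)
       (use fin bdd in \<open>auto intro!: opn open_half_polar open_Collect_less continuous_intros\<close>)
  ultimately show ?thesis using upper by linarith
qed

end

section \<open>Volume bounds in dimensions two and three\<close>

text \<open>The \<open>J + 1\<close> copies of \<open>Y\<close> along \<open>v\<close> have total
  measure above \<open>1\<close>, so two of them meet modulo the lattice. Either the copies or the
  lattice shifts differ, hence \<open>(p, j)\<close> is nonzero.\<close>

lemma cylinder_lattice_point:
  fixes Y :: "(real^'n) set" and v :: "real^'n"
  assumes Y: "Y \<in> lmeasurable" "bounded Y" and big: "1 < (real J + 1) * measure lebesgue Y"
  obtains p y y' and j :: int where "\<forall>k. p $ k \<in> \<int>" "\<bar>j\<bar> \<le> int J" "y \<in> Y" "y' \<in> Y"
    "p = of_int j *\<^sub>R v + (y - y')" "(p, j) \<noteq> (0, 0)"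
proof -
  let ?X = "\<lambda>i::nat. (+) (real i *\<^sub>R v) ` Y"
  have "(\<Sum>i\<le>J. measure lebesgue (?X i)) = (real J + 1) * measure lebesgue Y"
    by (simp add: measure_translation)
  then have "\<not> (\<Sum>i\<le>J. measure lebesgue (?X i)) \<le> 1" using big by linarith
  moreover have "?X i \<in> lmeasurable" "bounded (?X i)" for i
    using Y by (auto simp: measurable_translation bounded_translation)
  ultimately have "\<not> (\<forall>i i' z z'. i \<in> {..J} \<longrightarrow> i' \<in> {..J} \<longrightarrow> (\<forall>k. z $ k \<in> \<int>) \<longrightarrow> (\<forall>k. z' $ k \<in> \<int>)
      \<longrightarrow> (i, z) \<noteq> (i', z') \<longrightarrow> (+) z ` ?X i \<inter> (+) z' ` ?X i' = {})"
    using measure_lattice_packing_le_1[of "{..J}" ?X] by blast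
  then obtain i i' z z' where "i \<le> J" "i' \<le> J" and zz: "\<forall>k. z $ k \<in> \<int>" "\<forall>k. z' $ k \<in> \<int>"
      and ne: "(i, z) \<noteq> (i', z')" and common: "(+) z ` ?X i \<inter> (+) z' ` ?X i' \<noteq> {}"
    unfolding atMost_iff by blast
  then obtain y y' where y: "y \<in> Y" "y' \<in> Y" "z + (real i *\<^sub>R v + y) = z' + (real i' *\<^sub>R v + y')"
    by auto
  show ?thesis
  proof (rule that[of "z - z'" "int i' - int i" y' y])
    show "z - z' = of_int (int i' - int i) *\<^sub>R v + (y' - y)"
      using y(3) by (simp add: algebra_simps)
    show "(z - z', int i' - int i) \<noteq> (0, 0)" using ne by auto
  qed (use zz y \<open>i \<le> J\<close> \<open>i' \<le> J\<close> in auto)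
qed

lemma Ints_abs_less_1_eq_0: "x \<in> \<int> \<Longrightarrow> \<bar>x\<bar> < 1 \<Longrightarrow> x = (0::real)"
  by (auto elim!: Ints_cases)

lemma Ints_inner: "\<forall>k. u $ k \<in> \<int> \<Longrightarrow> \<forall>k. v $ k \<in> \<int> \<Longrightarrow> u \<bullet> v \<in> \<int>" for u v :: "real^'n"
  by (auto simp: inner_vec_def intro!: Ints_sum Ints_mult)

text \<open>The matrices over which \<open>Delta_alpha\<close> maximises. If \<open>N\<close>
  inverts such a matrix, row \<open>k\<close> of \<open>A ** N\<close> holds the coordinates of
  \<open>A $ k\<close> in the basis of its rows.\<close>

definition frame :: "real^'n \<Rightarrow> real^'n^'m \<Rightarrow> 'n \<Rightarrow> ('n \<Rightarrow> 'm) \<Rightarrow> real^'n^'n" where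
  "frame \<alpha> A j0 f = (\<chi> i. if i = j0 then \<alpha> else A $ f i)"

lemma Delta_alpha_ge:
  fixes A :: "real^'n^'m"
  shows "\<bar>det (frame \<alpha> A j0 f)\<bar> \<le> Delta_alpha \<alpha> A"
proof -
  let ?S = "{\<bar>det (\<chi> i. if i = j0 then \<alpha> else A $ (f i))\<bar> | (j0::'n) (f::'n \<Rightarrow> 'm). True}"
  have "?S = (\<lambda>(j0, f). \<bar>det (\<chi> i. if i = j0 then \<alpha> else A $ (f i))\<bar>) ` UNIV" by auto
  then have "finite ?S" by simp
  then show ?thesis unfolding Delta_alpha_def frame_def by (intro Max_ge) auto
qed

text \<open>Pigeonhole principle: the bodies \<open>N ` Y0\<close> shifted by \<open>(j / (\<alpha> \<bullet> w)) w\<close>, \<open>0 \<le> j \<le> \<alpha> \<bullet> w\<close>, overlap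
  modulo the integer lattice as soon as their total measure exceeds \<open>1\<close>. Integrality then forces the
  coordinates outside \<open>F\<close> of the difference to vanish.\<close>
lemma cylinder_bound:
  fixes A :: "real^'n^'m" and \<alpha> w :: "real^'n"
  assumes A_int: "\<forall>i j. A $ i $ j \<in> \<int>" and alpha_int: "\<forall>j. \<alpha> $ j \<in> \<int>" and pos: "0 < \<alpha> \<bullet> w"
    and only_0: "\<And>p t y. \<lbrakk>\<forall>k. p $ k \<in> \<int>; \<bar>t\<bar> \<le> 1; p = t *\<^sub>R w + y; \<And>k. \<bar>A $ k \<bullet> y\<bar> < 1\<rbrakk> \<Longrightarrow> p = 0"
    and zero: "\<And>i. i \<noteq> j0 \<Longrightarrow> i \<notin> F \<Longrightarrow> A $ f i \<bullet> w = 0" and j0: "j0 \<notin> F"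
    and N: "frame \<alpha> A j0 f ** N = mat 1" "N ** frame \<alpha> A j0 f = mat 1"
    and Y0: "Y0 \<in> lmeasurable" "bounded Y0"
    and diff: "\<And>x x' i. x \<in> Y0 \<Longrightarrow> x' \<in> Y0 \<Longrightarrow> i \<notin> F \<Longrightarrow> \<bar>x $ i - x' $ i\<bar> < 1"
    and diff_rows: "\<And>x x' k. x \<in> Y0 \<Longrightarrow> x' \<in> Y0 \<Longrightarrow> \<bar>\<Sum>i\<in>F. (A ** N) $ k $ i * (x $ i - x' $ i)\<bar> < 1"
  shows "(\<alpha> \<bullet> w) * measure lebesgue Y0 < \<bar>det (frame \<alpha> A j0 f)\<bar>"
proof (rule ccontr)
  let ?M = "frame \<alpha> A j0 f"
  assume "\<not> ?thesis"
  then have ge: "\<bar>det ?M\<bar> \<le> (\<alpha> \<bullet> w) * measure lebesgue Y0" by simp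
  have detN: "det N * det ?M = 1" using N(2) det_mul[of N ?M] by simp
  then have M0: "0 < \<bar>det ?M\<bar>" by auto
  have "\<bar>det N\<bar> * \<bar>det ?M\<bar> = 1" using detN by (simp add: abs_mult[symmetric])
  then have absN: "\<bar>det N\<bar> = 1 / \<bar>det ?M\<bar>" using M0 by (simp add: field_simps)
  define Y where "Y = (*v) N ` Y0"
  have Y: "Y \<in> lmeasurable" "measure lebesgue Y = measure lebesgue Y0 / \<bar>det ?M\<bar>"
    using linear_image_lebesgue_cart[OF matrix_vector_mul_linear[of N] Y0(1)] absN
    by (simp_all add: Y_def matrix_of_matrix_vector_mul)
  have "bounded Y" unfolding Y_def using Y0(2) by (intro bounded_linear_image matrix_vector_mul_bounded_linear)
  \<comment> \<open>\<open>J + 1\<close> copies exceed the critical volume, while shifts by at most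
    \<open>J\<close> steps keep \<open>\<bar>t\<bar> \<le> 1\<close>.\<close>
  define J where "J = nat \<lfloor>\<alpha> \<bullet> w\<rfloor>"
  have J: "real J \<le> \<alpha> \<bullet> w" "\<alpha> \<bullet> w < real J + 1" using pos by (auto simp: J_def)
  have "0 < measure lebesgue Y0" using ge M0 pos by (smt (verit) zero_less_mult_pos)
  then have "(\<alpha> \<bullet> w) * measure lebesgue Y0 < (real J + 1) * measure lebesgue Y0" using J(2) by simp
  then have "1 < (real J + 1) * measure lebesgue Y" using ge M0 by (simp add: Y(2) field_simps)
  \<comment> \<open>The step vector is scaled so that \<open>\<alpha>\<close> takes the value
    \<open>1\<close> on it; thus \<open>t * (\<alpha> \<bullet> w) = j\<close> is an
    integer.\<close>
  from cylinder_lattice_point[OF Y(1) \<open>bounded Y\<close> this, of "(1 / (\<alpha> \<bullet> w)) *\<^sub>R w"]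
  obtain p y y' j where p: "\<forall>k. p $ k \<in> \<int>" and j: "\<bar>j\<bar> \<le> int J" and y: "y \<in> Y" "y' \<in> Y"
    and peq: "p = of_int j *\<^sub>R ((1 / (\<alpha> \<bullet> w)) *\<^sub>R w) + (y - y')" and ne: "(p, j) \<noteq> (0, 0)" .
  define t where "t = of_int j / (\<alpha> \<bullet> w)"
  have pt: "p = t *\<^sub>R w + (y - y')" using peq by (simp add: t_def)
  obtain x x' where x: "x \<in> Y0" "x' \<in> Y0" "y = N *v x" "y' = N *v x'" using y by (auto simp: Y_def)
  have My: "?M *v (y - y') = x - x'"
    by (simp add: x(3,4) matrix_vector_mult_diff_distrib[symmetric] matrix_vector_mul_assoc N)
  have Mi: "?M $ i \<bullet> (y - y') = x $ i - x' $ i" for i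
    using arg_cong[OF My, of "\<lambda>v. v $ i"] by (simp add: matrix_vector_mul_component)
  have M_int: "\<forall>k. ?M $ i $ k \<in> \<int>" for i using A_int alpha_int by (auto simp: frame_def)
  have Mw: "t * (?M $ i \<bullet> w) \<in> \<int>" if "i \<notin> F" for i
    using that zero[of i] pos by (auto simp: frame_def t_def)
  have x0: "x $ i - x' $ i = 0" if "i \<notin> F" for i
  proof (rule Ints_abs_less_1_eq_0)
    have "x $ i - x' $ i = ?M $ i \<bullet> p - t * (?M $ i \<bullet> w)" using Mi[of i] by (simp add: pt inner_add_right)
    then show "x $ i - x' $ i \<in> \<int>" using Mw[OF that] Ints_inner[OF M_int p] by simp
    show "\<bar>x $ i - x' $ i\<bar> < 1" using diff x that by blast
  qed
  have "\<bar>A $ k \<bullet> (y - y')\<bar> < 1" for k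
  proof -
    have "A *v (y - y') = (A ** N) *v (x - x')"
      by (simp add: x(3,4) matrix_vector_mult_diff_distrib matrix_vector_mul_assoc)
    then have "A $ k \<bullet> (y - y') = (\<Sum>i\<in>UNIV. (A ** N) $ k $ i * (x $ i - x' $ i))"
      by (simp add: vec_eq_iff matrix_vector_mul_component inner_vec_def)
    also have "\<dots> = (\<Sum>i\<in>F. (A ** N) $ k $ i * (x $ i - x' $ i))"
      by (rule sum.mono_neutral_right) (use x0 in auto)
    finally show ?thesis using diff_rows x by simp
  qed
  moreover have "\<bar>t\<bar> \<le> 1" using j J(1) pos by (simp add: t_def abs_le_iff field_simps)
  ultimately have "p = 0" using only_0[OF p _ pt] by blast
  \<comment> \<open>With \<open>p = 0\<close>, row \<open>j0\<close> of the frame reads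
    \<open>0 = j\<close>, contradicting \<open>(p, j) \<noteq> (0, 0)\<close>.\<close>
  moreover have "\<alpha> \<bullet> p = t * (\<alpha> \<bullet> w) + (x $ j0 - x' $ j0)"
    using Mi[of j0] by (simp add: pt inner_add_right frame_def)
  ultimately have "0 = t * (\<alpha> \<bullet> w) + (x $ j0 - x' $ j0)" by simp
  then have "j = 0" using x0[OF j0] pos by (simp add: t_def)
  then show False using ne \<open>p = 0\<close> by simp
qed

text \<open>Outside \<open>j0\<close> and \<open>F\<close> there are \<open>n - d\<close> indices,
  filled with independent rows that vanish on \<open>w\<close>. Their span misses
  \<open>\<alpha>\<close> because \<open>\<alpha> \<bullet> w \<noteq> 0\<close>; rows of
  \<open>A\<close> completing a basis go to \<open>F\<close>.\<close>

lemma nonsingular_frame_exists: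
  fixes A :: "real^'n^'m"
  assumes A_rank: "rank A = CARD('n)" and nz: "\<alpha> \<bullet> w \<noteq> 0"
    and d: "CARD('n) \<le> dim {g\<in>range (($) A). g \<bullet> w = 0} + d" and j0: "j0 \<notin> F" and F: "card F + 1 = d"
  shows "\<exists>f. (\<forall>i. i \<noteq> j0 \<longrightarrow> i \<notin> F \<longrightarrow> A $ f i \<bullet> w = 0) \<and> det (frame \<alpha> A j0 f) \<noteq> 0"
proof -
  let ?Z = "{g\<in>range (($) A). g \<bullet> w = 0}" and ?C = "- insert j0 F"
  have cC: "card ?C + d = CARD('n)"
  proof -
    have "card (insert j0 F) = d" using j0 F by simp
    then show ?thesis using card_mono[of UNIV "insert j0 F"] by (simp add: Compl_eq_Diff_UNIV card_Diff_subset)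
  qed
  obtain B1 where B1: "B1 \<subseteq> ?Z" "independent B1" "?Z \<subseteq> span B1" "card B1 = dim ?Z"
    by (rule basis_exists)
  have "card ?C \<le> card B1" using cC d B1(4) by linarith
  then obtain B0 where B0: "B0 \<subseteq> B1" "card B0 = card ?C" "finite B0" by (rule obtain_subset_with_card_n)
  have indB0: "independent B0" using B0(1) B1(2) independent_mono by blast
  have "\<alpha> \<notin> span B0"
  proof
    assume "\<alpha> \<in> span B0"
    then have "orthogonal w \<alpha>"
      by (rule orthogonal_to_span) (use B0(1) B1(1) in \<open>auto simp: orthogonal_def inner_commute\<close>)
    then show False using nz by (simp add: orthogonal_def inner_commute)
  qed
  then have ind: "independent (insert \<alpha> B0)" using indB0 by (simp add: independent_insertI)
  obtain B where B: "insert \<alpha> B0 \<subseteq> B" "B \<subseteq> insert \<alpha> B0 \<union> range (($) A)" "independent B"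
      "insert \<alpha> B0 \<union> range (($) A) \<subseteq> span B"
    using maximal_independent_subset_extend[OF _ ind, of "insert \<alpha> B0 \<union> range (($) A)"] by blast
  have "rows A = range (($) A)" by (auto simp: rows_def row_def)
  then have "dim (range (($) A)) = CARD('n)" using A_rank by (simp add: row_rank_def)
  then have "dim B = CARD('n)"
    using dim_subset[of "range (($) A)" "span B"] B(4) dim_subset_UNIV[of B] by (simp add: dim_span)
  then have spanB: "span B = UNIV" using dim_eq_full[of B] by simp
  have finB: "finite B" using B(3) independent_imp_finite by blast
  have cB: "card B = CARD('n)" using \<open>dim B = _\<close> B(3) by (simp add: dim_eq_card_independent)
  have aB: "\<alpha> \<notin> B0" using \<open>\<alpha> \<notin> span B0\<close> span_base by blast
  have "card (B - insert \<alpha> B0) = card F"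
    using B(1) B0(2,3) aB cB cC F by (simp add: card_Diff_subset)
  then obtain h2 where h2: "bij_betw h2 F (B - insert \<alpha> B0)"
    using finite_same_card_bij[of F "B - insert \<alpha> B0"] finB by auto
  obtain h1 where h1: "bij_betw h1 ?C B0" using finite_same_card_bij[of ?C B0] B0(2,3) by auto
  define h where "h i = (if i \<in> F then h2 i else h1 i)" for i
  have hA: "h i \<in> range (($) A)" if "i \<noteq> j0" for i
  proof (cases "i \<in> F")
    case True
    then have "h i \<in> B - insert \<alpha> B0" using h2 by (auto simp: h_def bij_betw_def)
    then show ?thesis using B(2) by auto
  next
    case False
    then have "h i \<in> B0" using that h1 by (auto simp: h_def bij_betw_def)
    then show ?thesis using B0(1) B1(1) by auto
  qed
  then have "\<forall>i. \<exists>k. i \<noteq> j0 \<longrightarrow> A $ k = h i" by (metis imageE)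
  then obtain f where f: "\<And>i. i \<noteq> j0 \<Longrightarrow> A $ f i = h i" by metis
  have "A $ f i \<bullet> w = 0" if "i \<noteq> j0" "i \<notin> F" for i
  proof -
    have "h i \<in> B0" using that h1 by (auto simp: h_def bij_betw_def)
    then show ?thesis using B0(1) B1(1) f[OF that(1)] by auto
  qed
  moreover have "det (frame \<alpha> A j0 f) \<noteq> 0"
  proof -
    have "B \<subseteq> rows (frame \<alpha> A j0 f)"
    proof
      fix g assume "g \<in> B"
      then consider "g = \<alpha>" | "g \<in> B0" | "g \<in> B - insert \<alpha> B0" by blast
      then obtain i where "g = frame \<alpha> A j0 f $ i"
      proof cases
        case 1
        then show ?thesis using that[of j0] by (simp add: frame_def)
      next
        case 2
        then obtain i where i: "i \<in> ?C" "g = h1 i" using h1 by (auto simp: bij_betw_def)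
        then show ?thesis using that[of i] f[of i] by (simp add: frame_def h_def)
      next
        case 3
        then obtain i where i: "i \<in> F" "g = h2 i" using h2 by (auto simp: bij_betw_def)
        moreover have "i \<noteq> j0" using i j0 by blast
        ultimately show ?thesis using that[of i] f[of i] by (simp add: frame_def h_def)
      qed
      then show "g \<in> rows (frame \<alpha> A j0 f)" by (auto simp: rows_def row_def)
    qed
    then have "span B \<subseteq> span (rows (frame \<alpha> A j0 f))" by (rule span_mono)
    then have "span (rows (frame \<alpha> A j0 f)) = UNIV" using spanB by blast
    then have "invertible (frame \<alpha> A j0 f)"
      by (simp add: invertible_left_inverse matrix_left_invertible_span_rows)
    then show ?thesis by (simp add: invertible_det_nz)
  qed
  ultimately show ?thesis by blast
qed

text \<open>Maximality of the determinant under changes of the rows in \<open>F\<close> will bound,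
  by Cramer's rule, the \<open>F\<close>-coordinates of all rows of \<open>A\<close>.\<close>

lemma max_frame_exists:
  fixes A :: "real^'n^'m"
  assumes A_rank: "rank A = CARD('n)" and nz: "\<alpha> \<bullet> w \<noteq> 0"
    and d: "CARD('n) \<le> dim {g\<in>range (($) A). g \<bullet> w = 0} + d" and j0: "j0 \<notin> F" and F: "card F + 1 = d"
  obtains f N where "\<And>i. i \<noteq> j0 \<Longrightarrow> i \<notin> F \<Longrightarrow> A $ f i \<bullet> w = 0"
    "frame \<alpha> A j0 f ** N = mat 1" "N ** frame \<alpha> A j0 f = mat 1" "det (frame \<alpha> A j0 f) \<noteq> 0"
    "\<And>f'. (\<And>i. i \<notin> F \<Longrightarrow> f' i = f i) \<Longrightarrow> \<bar>det (frame \<alpha> A j0 f')\<bar> \<le> \<bar>det (frame \<alpha> A j0 f)\<bar>"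
proof -
  let ?S = "{f. \<forall>i. i \<noteq> j0 \<longrightarrow> i \<notin> F \<longrightarrow> A $ f i \<bullet> w = 0}"
  obtain f0 where f0: "f0 \<in> ?S" "det (frame \<alpha> A j0 f0) \<noteq> 0"
    using nonsingular_frame_exists[OF assms] by blast
  obtain f where f: "f \<in> ?S" "\<And>f'. f' \<in> ?S \<Longrightarrow> \<bar>det (frame \<alpha> A j0 f')\<bar> \<le> \<bar>det (frame \<alpha> A j0 f)\<bar>"
    using ex_is_arg_min_if_finite[of ?S "\<lambda>f. - \<bar>det (frame \<alpha> A j0 f)\<bar>"] f0(1)
    by (auto simp: is_arg_min_linorder)
  have det: "det (frame \<alpha> A j0 f) \<noteq> 0" using f(2)[OF f0(1)] f0(2) by auto
  then obtain N where "frame \<alpha> A j0 f ** N = mat 1" "N ** frame \<alpha> A j0 f = mat 1"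
    using invertible_det_nz[of "frame \<alpha> A j0 f"] unfolding invertible_def by blast
  then show ?thesis
  proof (rule that[rotated])
    show "\<bar>det (frame \<alpha> A j0 f')\<bar> \<le> \<bar>det (frame \<alpha> A j0 f)\<bar>" if "\<And>i. i \<notin> F \<Longrightarrow> f' i = f i" for f'
      using f that by (intro f(2)) auto
  qed (use f det in auto)
qed

lemma row_eq_frame_combination:
  fixes A :: "real^'n^'m"
  assumes "N ** frame \<alpha> A j0 f = mat 1"
  shows "A $ k = (\<Sum>j\<in>UNIV. (A ** N) $ k $ j *s frame \<alpha> A j0 f $ j)"
proof -
  have "A = (A ** N) ** frame \<alpha> A j0 f" using assms by (simp add: matrix_mul_assoc[symmetric])
  then have "A $ k $ i = (\<Sum>j\<in>UNIV. (A ** N) $ k $ j * frame \<alpha> A j0 f $ j $ i)" for i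
    by (metis (no_types, lifting) matrix_matrix_mult_def sum.cong vec_lambda_beta)
  then show ?thesis by (simp add: vec_eq_iff)
qed

lemma frame_replace_two:
  fixes A :: "real^'n^'m"
  assumes "N ** frame \<alpha> A j0 f = mat 1" "a \<noteq> b" "a \<noteq> j0" "b \<noteq> j0"
  shows "det (frame \<alpha> A j0 (f(a := k, b := l)))
    = ((A ** N) $ k $ a * (A ** N) $ l $ b - (A ** N) $ k $ b * (A ** N) $ l $ a) * det (frame \<alpha> A j0 f)"
proof -
  let ?M = "frame \<alpha> A j0 f"
  note row = row_eq_frame_combination[OF assms(1)]
  have "frame \<alpha> A j0 (f(a := k, b := l)) = (\<chi> i. if i = a then A $ k else if i = b then A $ l else ?M $ i)"
    using assms(2-) by (auto simp: frame_def vec_eq_iff)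
  also have "det \<dots> = ((A ** N) $ k $ a * (A ** N) $ l $ b - (A ** N) $ k $ b * (A ** N) $ l $ a) * det ?M"
    unfolding row[of k] row[of l] by (rule det_replace_two_rows[OF assms(2)])
  finally show ?thesis .
qed

lemma coordinates_of_frame_row:
  assumes "frame \<alpha> A j0 f ** N = mat 1" "a \<noteq> j0"
  shows "(A ** N) $ f a $ i = (if a = i then 1 else 0)"
proof -
  have "(A ** N) $ f a $ i = (frame \<alpha> A j0 f ** N) $ a $ i"
    using assms(2) by (simp add: matrix_matrix_mult_def frame_def)
  then show ?thesis using assms(1) by (simp add: mat_def)
qed

section \<open>The bounds for vectors in large kernels\<close>

text \<open>With \<open>F = {a}\<close>, maximality bounds every coordinate
  \<open>(A ** N) $ k $ a\<close> by \<open>1\<close>, so the open unit cube, of volume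
  \<open>1\<close>, can serve in \<open>cylinder_bound\<close>.\<close>

lemma two_dim_bound:
  fixes A :: "real^'n^'m" and \<alpha> w :: "real^'n"
  assumes n2: "2 \<le> CARD('n)" and A_rank: "rank A = CARD('n)"
    and A_int: "\<forall>i j. A $ i $ j \<in> \<int>" and alpha_int: "\<forall>j. \<alpha> $ j \<in> \<int>" and pos: "0 < \<alpha> \<bullet> w"
    and only_0: "\<And>p t y. \<lbrakk>\<forall>k. p $ k \<in> \<int>; \<bar>t\<bar> \<le> 1; p = t *\<^sub>R w + y; \<And>k. \<bar>A $ k \<bullet> y\<bar> < 1\<rbrakk> \<Longrightarrow> p = 0"
    and d: "CARD('n) \<le> dim {g\<in>range (($) A). g \<bullet> w = 0} + 2"
  shows "\<alpha> \<bullet> w < Delta_alpha \<alpha> A"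
proof -
  obtain T :: "'n set" where "card T = 2" using n2 obtain_subset_with_card_n by metis
  then obtain a j0 :: 'n where a: "a \<noteq> j0" by (auto simp: card_2_iff)
  obtain f N where f: "\<And>i. i \<noteq> j0 \<Longrightarrow> i \<notin> {a} \<Longrightarrow> A $ f i \<bullet> w = 0"
    and N: "frame \<alpha> A j0 f ** N = mat 1" "N ** frame \<alpha> A j0 f = mat 1" and det: "det (frame \<alpha> A j0 f) \<noteq> 0"
    and max: "\<And>f'. (\<And>i. i \<notin> {a} \<Longrightarrow> f' i = f i) \<Longrightarrow> \<bar>det (frame \<alpha> A j0 f')\<bar> \<le> \<bar>det (frame \<alpha> A j0 f)\<bar>"
    using max_frame_exists[OF A_rank _ d, of \<alpha> j0 "{a}"] pos a by auto
  let ?Y = "box 0 (\<chi> i. 1) :: (real^'n) set"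
  have coord: "\<bar>(A ** N) $ k $ a\<bar> \<le> 1" for k
  proof -
    let ?M = "frame \<alpha> A j0 f"
    note row = row_eq_frame_combination[OF N(2), of k]
    \<comment> \<open>Replacing one row is treated as replacing two, with row \<open>j0\<close>
      replaced by itself.\<close>
    have row': "?M $ j0 = (\<Sum>j\<in>UNIV. (if j = j0 then 1 else 0) *s ?M $ j)"
      by (simp add: vec_eq_iff if_distrib[of "\<lambda>x. x * _"] cong: if_cong)
    have "frame \<alpha> A j0 (f(a := k)) = (\<chi> i. if i = a then A $ k else if i = j0 then ?M $ j0 else ?M $ i)"
      using a by (auto simp: frame_def vec_eq_iff)
    also have "det \<dots> = (A ** N) $ k $ a * det ?M"
      unfolding row row' det_replace_two_rows[OF a] using a by simp
    finally have "\<bar>(A ** N) $ k $ a\<bar> * \<bar>det ?M\<bar> \<le> 1 * \<bar>det ?M\<bar>"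
      using max[of "f(a := k)"] by (simp add: abs_mult)
    then show ?thesis using det using mult_right_le_imp_le[of _ "\<bar>det (frame \<alpha> A j0 f)\<bar>" 1] by simp
  qed
  have Yd: "\<bar>x $ i - x' $ i\<bar> < 1" if "x \<in> ?Y" "x' \<in> ?Y" for x x' i
  proof -
    have "0 < x $ i" "x $ i < 1" "0 < x' $ i" "x' $ i < 1" using that by (auto simp: mem_box_cart)
    then show ?thesis by linarith
  qed
  have "(\<alpha> \<bullet> w) * measure lebesgue ?Y < \<bar>det (frame \<alpha> A j0 f)\<bar>"
  proof (rule cylinder_bound[OF A_int alpha_int pos only_0 f _ N])
    show "\<bar>\<Sum>i\<in>{a}. (A ** N) $ k $ i * (x $ i - x' $ i)\<bar> < 1" if "x \<in> ?Y" "x' \<in> ?Y" for x x' k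
    proof -
      have "\<bar>(A ** N) $ k $ a\<bar> * \<bar>x $ a - x' $ a\<bar> \<le> 1 * \<bar>x $ a - x' $ a\<bar>"
        by (rule mult_right_mono[OF coord]) simp
      then show ?thesis using Yd[OF that, of a] by (simp add: abs_mult)
    qed
  qed (use a Yd in \<open>auto simp: bounded_box\<close>)
  moreover have "measure lebesgue ?Y = 1"
    by (auto simp: measure_lborel_box_eq Basis_vec_def inner_axis intro!: prod.neutral)
  ultimately show ?thesis using Delta_alpha_ge[of \<alpha> A j0 f] by simp
qed

text \<open>With \<open>F = {a, b}\<close>, maximality bounds the cross products of the coordinate
  pairs \<open>\<kappa> k\<close> by \<open>1\<close>. The prism over their half polar has volume at
  least \<open>3/4\<close>, whence the factor \<open>4/3\<close>.\<close>

lemma three_dim_bound: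
  fixes A :: "real^'n^'m" and \<alpha> w :: "real^'n"
  assumes n3: "3 \<le> CARD('n)" and A_rank: "rank A = CARD('n)"
    and A_int: "\<forall>i j. A $ i $ j \<in> \<int>" and alpha_int: "\<forall>j. \<alpha> $ j \<in> \<int>" and pos: "0 < \<alpha> \<bullet> w"
    and only_0: "\<And>p t y. \<lbrakk>\<forall>k. p $ k \<in> \<int>; \<bar>t\<bar> \<le> 1; p = t *\<^sub>R w + y; \<And>k. \<bar>A $ k \<bullet> y\<bar> < 1\<rbrakk> \<Longrightarrow> p = 0"
    and d: "CARD('n) \<le> dim {g\<in>range (($) A). g \<bullet> w = 0} + 3"
  shows "\<alpha> \<bullet> w < 4/3 * Delta_alpha \<alpha> A"
proof -
  obtain T :: "'n set" where "card T = 3" using n3 obtain_subset_with_card_n by metis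
  then obtain a b j0 :: 'n where ab: "a \<noteq> b" and aj: "a \<noteq> j0" and bj: "b \<noteq> j0"
    by (auto simp: card_3_iff)
  obtain f N where f: "\<And>i. i \<noteq> j0 \<Longrightarrow> i \<notin> {a, b} \<Longrightarrow> A $ f i \<bullet> w = 0"
    and N: "frame \<alpha> A j0 f ** N = mat 1" "N ** frame \<alpha> A j0 f = mat 1" and det: "det (frame \<alpha> A j0 f) \<noteq> 0"
    and max: "\<And>f'. (\<And>i. i \<notin> {a, b} \<Longrightarrow> f' i = f i) \<Longrightarrow> \<bar>det (frame \<alpha> A j0 f')\<bar> \<le> \<bar>det (frame \<alpha> A j0 f)\<bar>"
    using max_frame_exists[OF A_rank _ d, of \<alpha> j0 "{a, b}"] pos ab aj bj by auto
  define \<kappa> where "\<kappa> k = ((A ** N) $ k $ a, (A ** N) $ k $ b)" for k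
  have cross: "\<bar>cross2 (\<kappa> k) (\<kappa> l)\<bar> \<le> 1" for k l
  proof -
    have "\<bar>cross2 (\<kappa> k) (\<kappa> l)\<bar> * \<bar>det (frame \<alpha> A j0 f)\<bar> \<le> 1 * \<bar>det (frame \<alpha> A j0 f)\<bar>"
      using max[of "f(a := k, b := l)"] frame_replace_two[OF N(2) ab aj bj, of k l]
      by (simp add: \<kappa>_def cross2_def abs_mult)
    then show ?thesis using det using mult_right_le_imp_le[of _ "\<bar>det (frame \<alpha> A j0 f)\<bar>" 1] by simp
  qed
  define G where "G = range \<kappa> \<union> uminus ` range \<kappa>"
  have cross2_minus: "cross2 (- g) h = - cross2 g h" "cross2 g (- h) = - cross2 g h" for g h
    by (simp_all add: cross2_def)
  have finG: "finite G" and symG: "\<And>g. g \<in> G \<Longrightarrow> - g \<in> G" by (auto simp: G_def)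
  have "\<kappa> (f a) = (1, 0)" "\<kappa> (f b) = (0, 1)"
    using coordinates_of_frame_row[OF N(1) aj] coordinates_of_frame_row[OF N(1) bj] ab
    by (simp_all add: \<kappa>_def)
  then have eG: "(1, 0) \<in> G" "(0, 1) \<in> G" unfolding G_def by (metis UnI1 rangeI)+
  have crossG: "cross2 g h \<le> 1" if "g \<in> G" "h \<in> G" for g h
    using that cross by (auto simp: G_def cross2_minus abs_le_iff)
  let ?K = "half_polar G" and ?Y = "prism a b (half_polar G) :: (real^'n) set"
  have K: "open ?K" "bounded ?K" by (simp_all add: open_half_polar finG half_polar_bounded eG symG)
  have "(\<alpha> \<bullet> w) * measure lebesgue ?Y < \<bar>det (frame \<alpha> A j0 f)\<bar>"
  proof (rule cylinder_bound[OF A_int alpha_int pos only_0 f _ N])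
    show "?Y \<in> lmeasurable" using K by (rule lmeasurable_prism)
    show "bounded ?Y" using K by (intro bounded_prism)
    show "\<bar>x $ i - x' $ i\<bar> < 1" if "x \<in> ?Y" "x' \<in> ?Y" "i \<notin> {a, b}" for x x' i
    proof -
      have "0 < x $ i" "x $ i < 1" "0 < x' $ i" "x' $ i < 1" using that by (auto simp: prism_def)
      then show ?thesis by linarith
    qed
    show "\<bar>\<Sum>i\<in>{a, b}. (A ** N) $ k $ i * (x $ i - x' $ i)\<bar> < 1" if "x \<in> ?Y" "x' \<in> ?Y" for x x' k
    proof -
      have half: "\<bar>\<kappa> k \<bullet> (z $ a, z $ b)\<bar> < 1/2" if "z \<in> ?Y" for z
      proof -
        have "(z $ a, z $ b) \<in> ?K" using that by (simp add: prism_def)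
        moreover have "\<kappa> k \<in> G" "- \<kappa> k \<in> G" by (auto simp: G_def)
        ultimately have "\<kappa> k \<bullet> (z $ a, z $ b) < 1/2" "- \<kappa> k \<bullet> (z $ a, z $ b) < 1/2"
          unfolding half_polar_def by blast+
        then show ?thesis by (simp add: abs_less_iff)
      qed
      have "(\<Sum>i\<in>{a, b}. (A ** N) $ k $ i * (x $ i - x' $ i)) = \<kappa> k \<bullet> (x $ a, x $ b) - \<kappa> k \<bullet> (x' $ a, x' $ b)"
        using ab by (simp add: \<kappa>_def inner2 algebra_simps)
      then show ?thesis using half[OF that(1)] half[OF that(2)] by linarith
    qed
  qed (use aj bj in auto)
  moreover have "3/4 \<le> measure lebesgue ?Y"
    by (rule area_half_polar_ge[OF ab finG symG eG crossG])
  then have "(\<alpha> \<bullet> w) * (3/4) \<le> (\<alpha> \<bullet> w) * measure lebesgue ?Y" using pos by (intro mult_left_mono) auto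
  ultimately show ?thesis using Delta_alpha_ge[of \<alpha> A j0 f] by linarith
qed

section \<open>Proximity\<close>

text \<open>Since \<open>t\<close> takes both signs, the property passes to \<open>- w\<close>, so
  that \<open>\<alpha> \<bullet> w\<close> may be assumed nonnegative.\<close>

definition only_zero_near :: "real^'n^'m \<Rightarrow> real^'n \<Rightarrow> bool" where
  "only_zero_near A w \<longleftrightarrow> (\<forall>p t y. (\<forall>k. p $ k \<in> \<int>) \<longrightarrow> \<bar>t\<bar> \<le> 1 \<longrightarrow> p = t *\<^sub>R w + y
      \<longrightarrow> (\<forall>k. \<bar>A $ k \<bullet> y\<bar> < 1) \<longrightarrow> p = 0)"

lemma only_zero_near_uminus:
  fixes w :: "real^'n"
  assumes "only_zero_near A w"
  shows "only_zero_near A (- w)"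
  unfolding only_zero_near_def
proof (intro allI impI)
  fix p y :: "real^'n" and t :: real
  assume p: "\<forall>k. p $ k \<in> \<int>" "\<bar>t\<bar> \<le> 1" "p = t *\<^sub>R - w + y" "\<forall>k. \<bar>A $ k \<bullet> y\<bar> < 1"
  then have "\<bar>- t\<bar> \<le> 1" "p = (- t) *\<^sub>R w + y" by simp_all
  then show "p = 0" using assms p(1,4) unfolding only_zero_near_def by blast
qed

lemma Delta_alpha_pos:
  fixes A :: "real^'n^'m"
  assumes "rank A = CARD('n)" "\<alpha> \<noteq> 0"
  shows "0 < Delta_alpha \<alpha> A"
proof -
  obtain j0 :: 'n where True by blast
  \<comment> \<open>With \<open>d = CARD('n)\<close> and \<open>w = \<alpha>\<close>, no row has to
    vanish on \<open>w\<close> and the dimension condition is trivial.\<close>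
  have "card (UNIV - {j0}) + 1 = CARD('n)" by (simp add: Suc_diff_1[OF zero_less_card_finite])
  then obtain f where "det (frame \<alpha> A j0 f) \<noteq> 0"
    using nonsingular_frame_exists[OF assms(1), of \<alpha> \<alpha> "CARD('n)" j0 "UNIV - {j0}"] assms(2) by auto
  then show ?thesis using Delta_alpha_ge[of \<alpha> A j0 f] by linarith
qed

text \<open>Splitting off a vector with \<open>d = 3\<close> costs \<open>4/3 = 12/9\<close> and
  lowers \<open>m\<close> by \<open>3\<close>. The base cases \<open>m = 2, 3, 4\<close> cost
  \<open>1\<close>, \<open>4/3\<close> and \<open>1 + 1\<close>, against allowances of
  \<open>10/9\<close>, \<open>14/9\<close> and \<open>18/9\<close>.\<close>

lemma spindle_bound:
  fixes A :: "real^'n^'m" and \<alpha> x :: "real^'n"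
  assumes n2: "2 \<le> CARD('n)" and A_rank: "rank A = CARD('n)"
    and A_int: "\<forall>i j. A $ i $ j \<in> \<int>" and alpha_int: "\<forall>j. \<alpha> $ j \<in> \<int>" and alpha_nz: "\<alpha> \<noteq> 0"
    and \<sigma>: "\<And>k. \<sigma> k = 1 \<or> \<sigma> k = (-1::real)" and G: "G = range (\<lambda>k. \<sigma> k *\<^sub>R A $ k)"
    and "\<And>g. g \<in> G \<Longrightarrow> 0 \<le> g \<bullet> x"
    and "\<And>w. (\<And>g. g \<in> G \<Longrightarrow> 0 \<le> g \<bullet> w \<and> g \<bullet> w \<le> g \<bullet> x) \<Longrightarrow> only_zero_near A w"
    and "2 \<le> m" "m \<le> CARD('n)" "CARD('n) \<le> dim {g\<in>G. g \<bullet> x = 0} + m"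
  shows "\<bar>\<alpha> \<bullet> x\<bar> < (4 * real m + 2) / 9 * Delta_alpha \<alpha> A"
proof -
  let ?D = "Delta_alpha \<alpha> A"
  have D: "0 < ?D" using A_rank alpha_nz by (rule Delta_alpha_pos)
  have finG: "finite G" by (simp add: G)
  have sub: "{g\<in>G. g \<bullet> w = 0} \<subseteq> span {g\<in>range (($) A). g \<bullet> w = 0}" for w
  proof
    fix g assume g: "g \<in> {g\<in>G. g \<bullet> w = 0}"
    then obtain k where k: "g = \<sigma> k *\<^sub>R A $ k" by (auto simp: G)
    then have "A $ k \<in> {g\<in>range (($) A). g \<bullet> w = 0}" using g \<sigma>[of k] by auto
    then show "g \<in> span {g\<in>range (($) A). g \<bullet> w = 0}" unfolding k by (intro span_scale span_base)
  qed
  have dimA: "dim {g\<in>G. g \<bullet> w = 0} \<le> dim {g\<in>range (($) A). g \<bullet> w = 0}" for w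
    using dim_subset[OF sub[of w]] by (simp add: dim_span)
  have "range (($) A) \<subseteq> span G"
  proof clarify
    fix k
    have "\<sigma> k *\<^sub>R (\<sigma> k *\<^sub>R A $ k) \<in> span G" unfolding G by (intro span_scale span_base) blast
    moreover have "\<sigma> k * \<sigma> k = 1" using \<sigma>[of k] by auto
    ultimately show "A $ k \<in> span G" by simp
  qed
  then have "dim (range (($) A)) \<le> dim G" using dim_subset[of _ "span G"] by (simp add: dim_span)
  moreover have "rows A = range (($) A)" by (auto simp: rows_def row_def)
  ultimately have dimG: "dim G = DIM(real^'n)"
    using A_rank dim_subset_UNIV[of G] by (simp add: row_rank_def)
  have neg: "\<exists>w'. only_zero_near A w' \<and> \<bar>\<alpha> \<bullet> w\<bar> = \<alpha> \<bullet> w' \<and> {g\<in>range (($) A). g \<bullet> w' = 0} = {g\<in>range (($) A). g \<bullet> w = 0}"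
    if "only_zero_near A w" for w
  proof (cases "0 \<le> \<alpha> \<bullet> w")
    case False
    then show ?thesis using only_zero_near_uminus[OF that] by (intro exI[of _ "- w"]) auto
  qed (use that in auto)
  have two: "\<bar>\<alpha> \<bullet> w\<bar> < ?D" if w: "only_zero_near A w" "CARD('n) \<le> dim {g\<in>G. g \<bullet> w = 0} + 2" for w
  proof -
    obtain w' where w': "only_zero_near A w'" "\<bar>\<alpha> \<bullet> w\<bar> = \<alpha> \<bullet> w'"
        "{g\<in>range (($) A). g \<bullet> w' = 0} = {g\<in>range (($) A). g \<bullet> w = 0}"
      using neg[OF w(1)] by blast
    have d: "CARD('n) \<le> dim {g\<in>range (($) A). g \<bullet> w' = 0} + 2" using dimA[of w] w(2) w'(3) by simp
    show ?thesis
    proof (cases "\<alpha> \<bullet> w' = 0")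
      case False
      then have "0 < \<alpha> \<bullet> w'" using w'(2) by linarith
      then show ?thesis unfolding w'(2)
        by (rule two_dim_bound[OF n2 A_rank A_int alpha_int _ _ d])
           (use w'(1) in \<open>unfold only_zero_near_def, blast\<close>)
    qed (use w'(2) D in simp)
  qed
  have three: "\<bar>\<alpha> \<bullet> w\<bar> < 4/3 * ?D"
    if n3: "3 \<le> CARD('n)" and w: "only_zero_near A w" "CARD('n) \<le> dim {g\<in>G. g \<bullet> w = 0} + 3" for w
  proof -
    obtain w' where w': "only_zero_near A w'" "\<bar>\<alpha> \<bullet> w\<bar> = \<alpha> \<bullet> w'"
        "{g\<in>range (($) A). g \<bullet> w' = 0} = {g\<in>range (($) A). g \<bullet> w = 0}"
      using neg[OF w(1)] by blast
    have d: "CARD('n) \<le> dim {g\<in>range (($) A). g \<bullet> w' = 0} + 3" using dimA[of w] w(2) w'(3) by simp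
    show ?thesis
    proof (cases "\<alpha> \<bullet> w' = 0")
      case False
      then have "0 < \<alpha> \<bullet> w'" using w'(2) by linarith
      then show ?thesis unfolding w'(2)
        by (rule three_dim_bound[OF n3 A_rank A_int alpha_int _ _ d])
           (use w'(1) in \<open>unfold only_zero_near_def, blast\<close>)
    qed (use w'(2) D in simp)
  qed
  show ?thesis using assms(8-)
  proof (induction m arbitrary: x rule: less_induct)
    case (less m)
    note x = less.prems(1) and ok = less.prems(2) and m = less.prems(3,4) and dim = less.prems(5)
    have okx: "only_zero_near A x" by (rule ok) (use x in auto)
    consider "m = 2" | "m = 3" | "m = 4" | "5 \<le> m" using m(1) by linarith
    then show ?case
    proof cases
      case 1
      then show ?thesis using two[OF okx] dim D by simp
    next
      case 2
      then have "\<bar>\<alpha> \<bullet> x\<bar> < 4/3 * ?D" using three[OF _ okx] dim m(2) by simp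
      then show ?thesis using D 2 by simp
    next
      case 3
      obtain w where w: "\<And>g. g \<in> G \<Longrightarrow> 0 \<le> g \<bullet> w \<and> g \<bullet> w \<le> g \<bullet> x"
          "DIM(real^'n) \<le> dim {g\<in>G. g \<bullet> w = 0} + 2" "DIM(real^'n) \<le> dim {g\<in>G. g \<bullet> (x - w) = 0} + 2"
        using spindle_split[OF finG dimG x, of 2 2] dim 3 by auto
      have "\<bar>\<alpha> \<bullet> w\<bar> < ?D" using w by (intro two ok) auto
      moreover have "\<bar>\<alpha> \<bullet> (x - w)\<bar> < ?D"
        using w by (intro two ok) (auto simp: inner_diff_right)
      ultimately show ?thesis using 3 by (simp add: inner_diff_right)
    next
      case 4
      obtain w where w: "\<And>g. g \<in> G \<Longrightarrow> 0 \<le> g \<bullet> w \<and> g \<bullet> w \<le> g \<bullet> x"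
          "DIM(real^'n) \<le> dim {g\<in>G. g \<bullet> w = 0} + 3" "DIM(real^'n) \<le> dim {g\<in>G. g \<bullet> (x - w) = 0} + (m - 3)"
        using spindle_split[OF finG dimG x, of 3 "m - 3"] dim 4 by auto
      have "\<bar>\<alpha> \<bullet> w\<bar> < 4/3 * ?D" using w 4 m(2) by (intro three ok) auto
      moreover have "\<bar>\<alpha> \<bullet> (x - w)\<bar> < (4 * real (m - 3) + 2) / 9 * ?D"
      proof (rule less.IH)
        show "0 \<le> g \<bullet> (x - w)" if "g \<in> G" for g using w(1)[OF that] by (simp add: inner_diff_right)
        \<comment> \<open>The spindle of \<open>x - w\<close> is contained in that of
          \<open>x\<close>.\<close>
        show "only_zero_near A v" if v: "\<And>g. g \<in> G \<Longrightarrow> 0 \<le> g \<bullet> v \<and> g \<bullet> v \<le> g \<bullet> (x - w)" for v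
        proof (rule ok)
          show "0 \<le> g \<bullet> v \<and> g \<bullet> v \<le> g \<bullet> x" if "g \<in> G" for g
            using v[OF that] w(1)[OF that] by (simp add: inner_diff_right)
        qed
      qed (use w(3) 4 m(2) in auto)
      moreover have "4/3 * ?D + (4 * real (m - 3) + 2) / 9 * ?D = (4 * real m + 2) / 9 * ?D"
        using 4 by (simp add: of_nat_diff field_simps)
      moreover have "\<bar>\<alpha> \<bullet> x\<bar> \<le> \<bar>\<alpha> \<bullet> w\<bar> + \<bar>\<alpha> \<bullet> (x - w)\<bar>" by (simp add: inner_diff_right)
      ultimately show ?thesis by linarith
    qed
  qed
qed

text \<open>Applied to the entries of \<open>c\<close>, it makes the objective values at integer
  points discrete, so a bounded maximum is attained.\<close>

lemma common_denominator:
  fixes f :: "'i \<Rightarrow> real"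
  assumes "finite I" "\<And>i. i \<in> I \<Longrightarrow> f i \<in> \<rat>"
  shows "\<exists>d::int. 0 < d \<and> (\<forall>i\<in>I. of_int d * f i \<in> \<int>)"
  using assms
proof (induction I)
  case empty
  then show ?case by (intro exI[of _ 1]) simp
next
  case (insert i I)
  then obtain d where d: "0 < d" "\<forall>i\<in>I. of_int d * f i \<in> \<int>" by blast
  obtain a b where b: "0 < b" "f i = of_int a / of_int b"
    using insert.prems[of i] by (metis Rats_cases' insertI1)
  have "of_int (d * b) * f k \<in> \<int>" if "k \<in> insert i I" for k
  proof (cases "k = i")
    case True
    then have "of_int (d * b) * f k = of_int (d * a)" using b by simp
    then show ?thesis by (metis Ints_of_int)
  next
    case False
    then have "of_int d * f k \<in> \<int>" using that d(2) by blast
    then have "of_int b * (of_int d * f k) \<in> \<int>" by (rule Ints_mult[OF Ints_of_int])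
    then show ?thesis by (simp add: mult.commute mult.left_commute)
  qed
  then show ?case using d(1) b(1) by (intro exI[of _ "d * b"]) auto
qed

lemma mem_polyhedron_of: "x \<in> polyhedron_of A b \<longleftrightarrow> (\<forall>k. A $ k \<bullet> x \<le> b $ k)"
  by (simp add: polyhedron_of_def matrix_vector_mul_component)

text \<open>Tight rows do not grow along \<open>d\<close>, and every other row has slack for some
  positive step; the least of finitely many such steps works.\<close>

lemma small_step_feasible:
  fixes A :: "real^'n^'m"
  assumes x: "x \<in> polyhedron_of A b" and d: "\<And>k. A $ k \<bullet> x = b $ k \<Longrightarrow> A $ k \<bullet> d \<le> 0"
  shows "\<exists>e>0. \<forall>s. 0 \<le> s \<longrightarrow> s \<le> e \<longrightarrow> x + s *\<^sub>R d \<in> polyhedron_of A b"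
proof -
  have "\<exists>e>0. \<forall>s. 0 \<le> s \<longrightarrow> s \<le> e \<longrightarrow> A $ k \<bullet> (x + s *\<^sub>R d) \<le> b $ k" for k
  proof (cases "A $ k \<bullet> d \<le> 0")
    case True
    then have "A $ k \<bullet> (x + s *\<^sub>R d) \<le> b $ k" if "0 \<le> s" for s
      using x mult_nonneg_nonpos[OF that True] by (auto simp: mem_polyhedron_of inner_add_right intro: add_decreasing2)
    then show ?thesis by (intro exI[of _ 1]) auto
  next
    case False
    then have lt: "A $ k \<bullet> x < b $ k" using d x by (auto simp: mem_polyhedron_of order_less_le)
    let ?e = "(b $ k - A $ k \<bullet> x) / (A $ k \<bullet> d)"
    have "s * (A $ k \<bullet> d) \<le> b $ k - A $ k \<bullet> x" if "s \<le> ?e" for s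
      using that False by (simp add: pos_le_divide_eq)
    then have "\<forall>s. 0 \<le> s \<longrightarrow> s \<le> ?e \<longrightarrow> A $ k \<bullet> (x + s *\<^sub>R d) \<le> b $ k"
      by (auto simp: inner_add_right algebra_simps)
    moreover have "0 < ?e" using lt False by simp
    ultimately show ?thesis by blast
  qed
  then obtain e where e: "\<And>k. 0 < e k" "\<And>k s. 0 \<le> s \<Longrightarrow> s \<le> e k \<Longrightarrow> A $ k \<bullet> (x + s *\<^sub>R d) \<le> b $ k"
    by metis
  have "0 < Min (range e)" using e(1) by (simp add: Min_gr_iff)
  moreover have "s \<le> e k" if "s \<le> Min (range e)" for s k using that by simp
  ultimately show ?thesis using e(2) unfolding mem_polyhedron_of by blast
qed

theorem theorem5:
  fixes A :: "real^'n^'m" and \<alpha> :: "real^'n" and b :: "real^'m" and c :: "real^'n"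
    and xstar :: "real^'n"
  assumes n2: "CARD('n) \<ge> 2"
    and A_int: "\<forall>i j. A $ i $ j \<in> \<int>"
    and A_rank: "rank A = CARD('n)"
    and alpha_int: "\<forall>j. \<alpha> $ j \<in> \<int>"
    and alpha_nz: "\<alpha> \<noteq> 0"
    and b_int: "\<forall>i. b $ i \<in> \<int>"
    and c_rat: "\<forall>j. c $ j \<in> \<rat>"
    and x_vertex: "xstar extreme_point_of (polyhedron_of A b)"
    and x_opt: "\<forall>y \<in> polyhedron_of A b. c \<bullet> y \<le> c \<bullet> xstar"
    and ip_feasible: "\<exists>z \<in> polyhedron_of A b. \<forall>j. z $ j \<in> \<int>"
  shows "\<exists>zstar \<in> polyhedron_of A b. (\<forall>j. zstar $ j \<in> \<int>)
           \<and> (\<forall>z \<in> polyhedron_of A b. (\<forall>j. z $ j \<in> \<int>) \<longrightarrow> c \<bullet> z \<le> c \<bullet> zstar)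
           \<and> \<bar>\<alpha> \<bullet> (xstar - zstar)\<bar> < (4 * real CARD('n) + 2) / 9 * Delta_alpha \<alpha> A"
proof -
  let ?P = "polyhedron_of A b"
  let ?F = "\<lambda>z. z \<in> ?P \<and> (\<forall>j. z $ j \<in> \<int>)"
  define T where "T = {k. A $ k \<bullet> xstar = b $ k}"
  have xP: "xstar \<in> ?P" using x_vertex by (simp add: extreme_point_of_def)
  have row_int: "A $ k \<bullet> z \<in> \<int>" if "\<forall>j. z $ j \<in> \<int>" for k z using A_int that by (intro Ints_inner) auto
  obtain z1 where z1: "?F z1" and z1_max: "\<And>z. ?F z \<Longrightarrow> c \<bullet> z \<le> c \<bullet> z1"
  proof -
    obtain d :: int where d: "0 < d" "\<forall>j\<in>UNIV. of_int d * c $ j \<in> \<int>"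
      using common_denominator[of UNIV "\<lambda>j. c $ j"] c_rat by auto
    have int: "of_int d * (c \<bullet> z) \<in> \<int>" if "?F z" for z
    proof -
      have "of_int d * (c \<bullet> z) = (of_int d *\<^sub>R c) \<bullet> z" by simp
      also have "\<dots> \<in> \<int>" using d(2) that by (intro Ints_inner) auto
      finally show ?thesis .
    qed
    \<comment> \<open>\<open>of_int d * (c \<bullet> z)\<close> is an integer of at most
      \<open>of_int d * (c \<bullet> xstar)\<close>, so \<open>nat\<close> cuts nothing off and
      minimising \<open>?V\<close> maximises \<open>c \<bullet> z\<close>.\<close>
    let ?V = "\<lambda>z. nat \<lfloor>of_int d * (c \<bullet> xstar) - of_int d * (c \<bullet> z)\<rfloor>"
    obtain z0 where "?F z0" using ip_feasible by blast
    from ex_has_least_nat[of ?F, OF this, of ?V]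
    obtain z1 where z1: "?F z1" "\<And>z. ?F z \<Longrightarrow> ?V z1 \<le> ?V z" by blast
    have "c \<bullet> z \<le> c \<bullet> z1" if z: "?F z" for z
    proof -
      obtain i i1 where i: "of_int d * (c \<bullet> z) = of_int i" "of_int d * (c \<bullet> z1) = of_int i1"
        using int[OF z] int[OF z1(1)] by (metis Ints_cases)
      have "of_int d * (c \<bullet> z) \<le> of_int d * (c \<bullet> xstar)"
        using x_opt z d(1) by (intro mult_left_mono) auto
      then have "i \<le> \<lfloor>of_int d * (c \<bullet> xstar)\<rfloor>" using i(1) by (simp add: le_floor_iff)
      then have "i \<le> i1" using z1(2)[OF z] unfolding i by simp
      then have "of_int d * (c \<bullet> z) \<le> of_int d * (c \<bullet> z1)" unfolding i by simp
      then show ?thesis using d(1) by simp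
    qed
    then show ?thesis using that z1(1) by blast
  qed
  let ?O = "\<lambda>z. ?F z \<and> c \<bullet> z = c \<bullet> z1"
  \<comment> \<open>The slack at the tight rows is a nonnegative integer at feasible integer points,
    so minimising its \<open>nat\<close> value minimises it.\<close>
  let ?s = "\<lambda>z. \<Sum>k\<in>T. b $ k - A $ k \<bullet> z"
  have "?O z1" using z1 by blast
  from ex_has_least_nat[of ?O, OF this, of "\<lambda>z. nat \<lfloor>?s z\<rfloor>"]
  obtain z where z: "?O z" and z_min: "\<And>z'. ?O z' \<Longrightarrow> nat \<lfloor>?s z\<rfloor> \<le> nat \<lfloor>?s z'\<rfloor>" by blast
  have s_min: "?s z \<le> ?s z'" if z': "?O z'" for z'
  proof -
    have s_int: "?s y \<in> \<int>" if "?O y" for y using that b_int row_int by (intro Ints_sum Ints_diff) auto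
    obtain i where i: "?s z = of_int i" using s_int[OF z] by (rule Ints_cases)
    obtain i' where i': "?s z' = of_int i'" using s_int[OF z'] by (rule Ints_cases)
    have "0 \<le> ?s z'" using z' by (intro sum_nonneg) (auto simp: mem_polyhedron_of)
    then show ?thesis using z_min[OF z'] unfolding i i' by auto
  qed
  define \<sigma> where "\<sigma> k = (if 0 \<le> A $ k \<bullet> (xstar - z) then 1 else (-1::real))" for k
  define G where "G = range (\<lambda>k. \<sigma> k *\<^sub>R A $ k)"
  have near: "only_zero_near A w"
    if w: "\<And>g. g \<in> G \<Longrightarrow> 0 \<le> g \<bullet> w \<and> g \<bullet> w \<le> g \<bullet> (xstar - z)" for w
  proof -
    have key: "p = 0" if p: "\<forall>k. p $ k \<in> \<int>" and t: "0 \<le> t" "t \<le> 1" and pe: "p = t *\<^sub>R w + y"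
        and y: "\<And>k. \<bar>A $ k \<bullet> y\<bar> < 1" for p t y
    proof -
      have wk: "0 \<le> \<sigma> k * (A $ k \<bullet> w)" "\<sigma> k * (A $ k \<bullet> w) \<le> \<sigma> k * (A $ k \<bullet> (xstar - z))" for k
        using w[of "\<sigma> k *\<^sub>R A $ k"] by (auto simp: G_def)
      have Ap: "A $ k \<bullet> p = t * (A $ k \<bullet> w) + A $ k \<bullet> y" for k by (simp add: pe inner_add_right)
      \<comment> \<open>The part from \<open>w\<close> is nonnegative and the part from
        \<open>y\<close> exceeds \<open>-1\<close>; an integer above \<open>-1\<close> is
        nonnegative.\<close>
      have sp: "0 \<le> \<sigma> k * (A $ k \<bullet> p)" for k
      proof -
        have "0 \<le> t * (\<sigma> k * (A $ k \<bullet> w))" by (rule mult_nonneg_nonneg[OF t(1) wk(1)])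
        moreover have "- 1 < \<sigma> k * (A $ k \<bullet> y)" using y[of k] by (auto simp: \<sigma>_def abs_less_iff)
        moreover have "\<sigma> k * (A $ k \<bullet> p) = t * (\<sigma> k * (A $ k \<bullet> w)) + \<sigma> k * (A $ k \<bullet> y)"
          by (simp add: Ap algebra_simps)
        ultimately have "- 1 < \<sigma> k * (A $ k \<bullet> p)" by linarith
        moreover have "\<sigma> k * (A $ k \<bullet> p) \<in> \<int>" using row_int[OF p] by (auto simp: \<sigma>_def)
        ultimately show ?thesis by (auto elim!: Ints_cases)
      qed
      \<comment> \<open>If row \<open>k\<close> is nonnegative on \<open>xstar - z\<close>, its
        value at \<open>z + p\<close> exceeds that at \<open>xstar\<close> by less than
        \<open>1\<close>, which integrality of \<open>b\<close> removes. Otherwise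
        \<open>A $ k \<bullet> p \<le> 0\<close>.\<close>
      have "A $ k \<bullet> (z + p) \<le> b $ k" for k
      proof (cases "0 \<le> A $ k \<bullet> (xstar - z)")
        case True
        then have wk': "0 \<le> A $ k \<bullet> w" "A $ k \<bullet> w \<le> A $ k \<bullet> (xstar - z)" using wk[of k] by (auto simp: \<sigma>_def)
        have "t * (A $ k \<bullet> w) \<le> 1 * (A $ k \<bullet> w)" using t(2) wk'(1) by (rule mult_right_mono)
        then have "A $ k \<bullet> p < A $ k \<bullet> (xstar - z) + 1" using wk'(2) y[of k] Ap[of k] by linarith
        then have "A $ k \<bullet> (z + p) < b $ k + 1"
          using xP by (simp add: mem_polyhedron_of inner_diff_right inner_add_right) (smt (verit))
        moreover have "A $ k \<bullet> (z + p) \<in> \<int>" using z p by (intro row_int) auto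
        moreover have "b $ k \<in> \<int>" using b_int by blast
        ultimately show ?thesis by (auto elim!: Ints_cases)
      next
        case False
        then have "A $ k \<bullet> p \<le> 0" using sp[of k] by (simp add: \<sigma>_def)
        then show ?thesis using z by (auto simp: mem_polyhedron_of inner_add_right intro: add_decreasing2)
      qed
      then have zp: "?F (z + p)" using z p by (auto simp: mem_polyhedron_of)
      have tight: "0 \<le> A $ k \<bullet> p" if "k \<in> T" for k
      proof -
        have "0 \<le> A $ k \<bullet> (xstar - z)" using that z by (auto simp: T_def mem_polyhedron_of inner_diff_right)
        then show ?thesis using sp[of k] by (simp add: \<sigma>_def)
      qed
      \<comment> \<open>By \<open>tight\<close>, \<open>- p\<close> is a feasible direction at
        \<open>xstar\<close>. Optimality of \<open>xstar\<close> gives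
        \<open>0 \<le> c \<bullet> p\<close>, so \<open>z + p\<close> is an optimal integer solution
        too.\<close>
      obtain e where "0 < e" "\<forall>s. 0 \<le> s \<longrightarrow> s \<le> e \<longrightarrow> xstar + s *\<^sub>R (- p) \<in> ?P"
        using small_step_feasible[OF xP, of "- p"] tight by (auto simp: T_def)
      then have "xstar + e *\<^sub>R (- p) \<in> ?P" by simp
      then have "c \<bullet> (xstar + e *\<^sub>R (- p)) \<le> c \<bullet> xstar" using x_opt by blast
      then have "0 \<le> e * (c \<bullet> p)" by (simp add: inner_diff_right)
      then have "0 \<le> c \<bullet> p" using \<open>0 < e\<close> by (simp add: zero_le_mult_iff)
      then have "?O (z + p)" using zp z z1_max[OF zp] by (auto simp: inner_add_right)
      \<comment> \<open>Passing to \<open>z + p\<close> lowers the slack by a sum of nonnegative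
        terms \<open>A $ k \<bullet> p\<close>; minimality makes all of them vanish.\<close>
      then have "?s z \<le> ?s (z + p)" by (rule s_min)
      then have "(\<Sum>k\<in>T. A $ k \<bullet> p) \<le> 0" by (simp add: inner_add_right sum_subtractf sum.distrib)
      then have "(\<Sum>k\<in>T. A $ k \<bullet> p) = 0" using tight by (intro antisym sum_nonneg) auto
      then have p0: "A $ k \<bullet> p = 0" if "k \<in> T" for k
        using that tight sum_nonneg_eq_0_iff[of T "\<lambda>k. A $ k \<bullet> p"] by auto
      show "p = 0"
      \<comment> \<open>A nonzero \<open>p\<close> orthogonal to all tight rows could be followed in
        both directions, placing the vertex inside a segment of the polyhedron.\<close>
      proof (rule ccontr)
        assume "p \<noteq> 0"
        obtain e1 where e1: "0 < e1" "\<forall>s. 0 \<le> s \<longrightarrow> s \<le> e1 \<longrightarrow> xstar + s *\<^sub>R p \<in> ?P"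
          using small_step_feasible[OF xP, of p] p0 by (auto simp: T_def)
        obtain e2 where e2: "0 < e2" "\<forall>s. 0 \<le> s \<longrightarrow> s \<le> e2 \<longrightarrow> xstar + s *\<^sub>R (- p) \<in> ?P"
          using small_step_feasible[OF xP, of "- p"] p0 by (auto simp: T_def)
        define s where "s = min e1 e2"
        have s: "0 < s" "xstar + s *\<^sub>R p \<in> ?P" "xstar - s *\<^sub>R p \<in> ?P"
          using e1 e2(1) e2(2)[rule_format, of s] by (auto simp: s_def)
        have "xstar = midpoint (xstar + s *\<^sub>R p) (xstar - s *\<^sub>R p)"
          by (simp add: midpoint_def algebra_simps scaleR_2[symmetric])
        moreover have "xstar + s *\<^sub>R p \<noteq> xstar - s *\<^sub>R p"
        proof
          assume "xstar + s *\<^sub>R p = xstar - s *\<^sub>R p"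
          then have "(2 * s) *\<^sub>R p = 0" by (simp add: algebra_simps scaleR_2[symmetric] flip: scaleR_scaleR)
          then show False using s(1) \<open>p \<noteq> 0\<close> by simp
        qed
        ultimately have "xstar \<in> open_segment (xstar + s *\<^sub>R p) (xstar - s *\<^sub>R p)"
          by (metis midpoint_in_open_segment)
        then show False using x_vertex s(2,3) by (auto simp: extreme_point_of_def)
      qed
    qed
    show ?thesis unfolding only_zero_near_def
    proof (intro allI impI)
      fix p y t assume p: "\<forall>k. p $ k \<in> \<int>" "\<bar>t\<bar> \<le> 1" "p = t *\<^sub>R w + y" "\<forall>k. \<bar>A $ k \<bullet> y\<bar> < 1"
      show "p = 0"
      proof (cases "0 \<le> t")
        case True
        then show ?thesis using key[of p t y] p by auto
      next
        case False
        have "\<forall>k. (- p) $ k \<in> \<int>" using p(1) by simp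
        then have "- p = 0" by (rule key[of _ "- t" "- y"]) (use False p in auto)
        then show ?thesis by simp
      qed
    qed
  qed
  have "\<bar>\<alpha> \<bullet> (xstar - z)\<bar> < (4 * real CARD('n) + 2) / 9 * Delta_alpha \<alpha> A"
  \<comment> \<open>Here \<open>m = CARD('n)\<close>, for which the dimension condition is
    trivial.\<close>
  proof (rule spindle_bound[OF n2 A_rank A_int alpha_int alpha_nz _ G_def _ near n2])
    show "0 \<le> g \<bullet> (xstar - z)" if "g \<in> G" for g using that by (auto simp: G_def \<sigma>_def)
  qed (auto simp: \<sigma>_def)
  then show ?thesis using z z1_max by (intro bexI[of _ z]) auto
qed

end
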